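(* Let $V$ be a complex vector space with $\dim V = 5$ and let $f \in S^3 V$. Consider the Ruppert map \[ \rho^{(2)}_f : \mathfrak{sl}^{(1)}(V) \to S^{4} V . \] If $f$ is generic, then $\operatorname{rank}(\rho^{(2)}_f) = 60$, whereas if $\mathrm{slrk}(f) \leq 2$ then $\operatorname{rank}(\rho^{(2)}_f) \leq 59$. In particular, the minors of size $60$ of $\rho^{(2)}_f$ define equations of degree $60$ for $\sigma_2(\mathcal{R}^1_{4,3})$ (that is, they are polynomials of degree $60$ in the coefficients of $f$, not all identically zero, which vanish on $\sigma_2(\mathcal{R}^1_{4,3})$).
   Context: $S^dV$ is the space of homogeneous polynomials of degree $d$ in a basis $x_0,\dots,x_4$ of $V$; $\partial_0,\dots,\partial_4$ is the dual basis of $V^*$, acting on polynomials by $\partial_i\cdot g=\partial g/\partial x_i$. Set \[ \mathfrak{sl}^{(1)}(V)=\Bigl\{\textstyle\sum_{i=0}^4\partial_i\otimes g_i : \sum_{i=0}^4 \partial_i g_i=0\Bigr\}\subseteq V^*\otimes S^2V , \] and for $f\in S^3V$ define the Ruppert map $\rho_f^{(2)}:\mathfrak{sl}^{(1)}(V)\to S^4V$ by $\sum_i g_i\otimes\partial_i\mapsto\sum_i g_i\,\partial_i f$. The slice rank $\mathrm{slrk}(f)$ of $f\in S^dV$ is the smallest $r\in\mathbb{N}$ such that $f=\sum_{i=1}^r\ell_ih_i$ with $\ell_i\in S^1V$, $h_i\in S^{d-1}V$. $\mathcal{R}^1_{4,3}\subseteq\mathbb{P}S^3V$ is the variety of classes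 of cubic forms having a linear factor, and $\sigma_2(\mathcal{R}^1_{4,3})$ is its second secant variety, i.e. the Zariski closure of the union of the lines spanned by pairs of points of $\mathcal{R}^1_{4,3}$. "Generic $f$" means $f$ in some nonempty Zariski open subset of $S^3V$. *)

theory Defs
  imports "HOL-Analysis.Analysis" "HOL-Library.Poly_Mapping"
begin

section \<open>Polynomials over the complex numbers\<close>

text \<open>A monomial is its finitely supported exponent vector; the ring structure on polynomials is
  the convolution product of \<^theory>\<open>HOL-Library.Poly_Mapping\<close>.\<close>

type_synonym 'v mpoly = "('v \<Rightarrow>\<^sub>0 nat) \<Rightarrow>\<^sub>0 complex"

definition smul :: "complex \<Rightarrow> 'v mpoly \<Rightarrow> 'v mpoly" where
  "smul c p = Poly_Mapping.single 0 c * p"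

definition mdeg :: "('v \<Rightarrow>\<^sub>0 nat) \<Rightarrow> nat" where
  "mdeg m = (\<Sum>v\<in>Poly_Mapping.keys m. Poly_Mapping.lookup m v)"

text \<open>Homogeneous polynomials of degree \<open>d\<close>, the zero polynomial included.\<close>

definition forms :: "nat \<Rightarrow> 'v mpoly set" where
  "forms d = {p. \<forall>m\<in>Poly_Mapping.keys p. mdeg m = d}"

definition pdiff :: "'v \<Rightarrow> 'v mpoly \<Rightarrow> 'v mpoly" where
  "pdiff i p = (\<Sum>m\<in>Poly_Mapping.keys p.
     Poly_Mapping.single (m - Poly_Mapping.single i 1)
       (of_nat (Poly_Mapping.lookup m i) * Poly_Mapping.lookup p m))"

definition eval_mpoly :: "'v mpoly \<Rightarrow> ('v \<Rightarrow> complex) \<Rightarrow> complex" where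
  "eval_mpoly P a = (\<Sum>m\<in>Poly_Mapping.keys P.
     Poly_Mapping.lookup P m * (\<Prod>v\<in>Poly_Mapping.keys m. a v ^ Poly_Mapping.lookup m v))"

global_interpretation mpoly: vector_space "smul :: complex \<Rightarrow> 'v mpoly \<Rightarrow> 'v mpoly"
proof
  fix a b :: complex and x y :: "'v mpoly"
  show "smul a (x + y) = smul a x + smul a y"
    by (simp add: smul_def distrib_left)
  show "smul (a + b) x = smul a x + smul b x"
    by (simp add: smul_def single_add distrib_right)
  show "smul a (smul b x) = smul (a * b) x"
    by (simp add: smul_def mult.assoc [symmetric] mult_single)
  show "smul 1 x = x"
    by (simp add: smul_def)
qed

section \<open>The Ruppert map of a form in five variables\<close>

text \<open>\<open>V\<close> is identified with the linear forms in five variables. The element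
  \<open>\<Sum>i. \<partial>\<^sub>i \<otimes> g\<^sub>i\<close> of \<open>V\<^sup>* \<otimes> S\<^sup>2V\<close> is encoded by the tuple \<open>(g\<^sub>i)\<^sub>i\<close>, which is possible
  because the \<open>\<partial>\<^sub>i\<close> form a basis of \<open>V\<^sup>*\<close>.\<close>

type_synonym form = "5 mpoly"

definition vmul :: "complex \<Rightarrow> form ^ 5 \<Rightarrow> form ^ 5" where
  "vmul c g = (\<chi> i. smul c (g $ i))"

global_interpretation vfield: vector_space vmul
  by unfold_locales (simp_all add: vmul_def vec_eq_iff mpoly.scale_right_distrib
      mpoly.scale_left_distrib)

definition sl1 :: "(form ^ 5) set" where
  "sl1 = {g. (\<forall>i. g $ i \<in> forms 2) \<and> (\<Sum>i\<in>UNIV. pdiff i (g $ i)) = 0}"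

definition ruppert :: "form \<Rightarrow> form ^ 5 \<Rightarrow> form" where
  "ruppert f g = (\<Sum>i\<in>UNIV. g $ i * pdiff i f)"

definition ruppert_rank :: "form \<Rightarrow> nat" where
  "ruppert_rank f = mpoly.dim (ruppert f ` sl1)"

text \<open>The square submatrix of the matrix of \<open>ruppert f\<close> whose columns are indexed by the vectors
  \<open>s j\<close> of a basis of \<^const>\<open>sl1\<close> and whose rows are indexed by the vectors \<open>r i\<close> of the basis \<open>C\<close>
  of the quartic forms. The matrix does not depend on the basis vectors of \<^const>\<open>sl1\<close> outside
  the range of \<open>s\<close>.\<close>

definition ruppert_minor :: "form set \<Rightarrow> ('k::finite \<Rightarrow> form) \<Rightarrow> ('k \<Rightarrow> form ^ 5) \<Rightarrow> form \<Rightarrow> complex" where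
  "ruppert_minor C r s f = det (\<chi> i j. mpoly.representation C (ruppert f (s j)) (r i))"

section \<open>Slice rank\<close>

definition slice_rank :: "nat \<Rightarrow> form \<Rightarrow> nat" where
  "slice_rank d f = (LEAST r. \<exists>l h. (\<forall>i<r. l i \<in> forms 1 \<and> h i \<in> forms (d - 1)) \<and>
     f = (\<Sum>i<r. l i * h i))"

section \<open>Polynomials in the coefficients and Zariski topology\<close>

text \<open>The coordinate ring of \<open>S\<^sup>dV\<close> is the polynomial ring in one variable for every monomial
  of degree \<open>d\<close>; the variable of a monomial stands for its coefficient.\<close>

type_synonym coeff_poly = "(5 \<Rightarrow>\<^sub>0 nat) mpoly"

definition coord_ring :: "nat \<Rightarrow> coeff_poly set" where
  "coord_ring d = {P. \<forall>m\<in>Poly_Mapping.keys P. \<forall>\<alpha>\<in>Poly_Mapping.keys m. mdeg \<alpha> = d}"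

definition eval_form :: "coeff_poly \<Rightarrow> form \<Rightarrow> complex" where
  "eval_form P f = eval_mpoly P (Poly_Mapping.lookup f)"

definition zariski_open :: "nat \<Rightarrow> form set \<Rightarrow> bool" where
  "zariski_open d U \<longleftrightarrow> (\<exists>T\<subseteq>coord_ring d. U = {f\<in>forms d. \<exists>P\<in>T. eval_form P f \<noteq> 0})"

text \<open>A point of the projective space of \<open>S\<^sup>dV\<close> is a line through the origin, as a set of forms.\<close>

definition proj_forms :: "nat \<Rightarrow> form set set" where
  "proj_forms d = {mpoly.span {f} | f. f \<in> forms d \<and> f \<noteq> 0}"

definition vanishes_on :: "coeff_poly \<Rightarrow> form set set \<Rightarrow> bool" where
  "vanishes_on P Z \<longleftrightarrow> (\<forall>p\<in>Z. \<forall>f\<in>p. eval_form P f = 0)"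

definition proj_closed :: "nat \<Rightarrow> form set set \<Rightarrow> bool" where
  "proj_closed d Z \<longleftrightarrow> (\<exists>T\<subseteq>coord_ring d \<inter> (\<Union>e. forms e).
     Z = {p\<in>proj_forms d. \<forall>P\<in>T. vanishes_on P {p}})"

definition proj_closure :: "nat \<Rightarrow> form set set \<Rightarrow> form set set" where
  "proj_closure d X = \<Inter>{Z. proj_closed d Z \<and> X \<subseteq> Z}"

definition proj_line :: "form set \<Rightarrow> form set \<Rightarrow> form set set" where
  "proj_line p q = {mpoly.span {f} | f. f \<in> mpoly.span (p \<union> q) \<and> f \<noteq> 0}"

definition secant2 :: "nat \<Rightarrow> form set set \<Rightarrow> form set set" where
  "secant2 d X = proj_closure d (\<Union>{proj_line p q | p q. p \<in> X \<and> q \<in> X \<and> p \<noteq> q})"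

definition reducible_cubics :: "form set set" where
  "reducible_cubics = {mpoly.span {f} | f. f \<in> forms 3 \<and> f \<noteq> 0 \<and>
     (\<exists>l\<in>forms 1. \<exists>h\<in>forms 2. f = l * h)}"

end

theory Submission
  imports Defs "HOL-Computational_Algebra.Polynomial"
begin

text \<open>The Ruppert map sends a divergence-free quadratic vector field \<open>\<theta> = \<Sum>i. g\<^sub>i \<partial>\<^sub>i\<close> to
  \<open>\<theta> f\<close>. Such fields have at most \<open>75 - 5 = 70\<close> degrees of freedom
  (\<open>sl1_spanned_by_70\<close>), so that upper bounds for the rank come from independent
  divergence-free fields that annihilate \<open>f\<close> (\<open>ruppert_rank_nullity_le\<close>).

  Every cubic is annihilated by the ten Koszul fields
  \<open>(\<partial>\<^sub>j f) \<partial>\<^sub>i - (\<partial>\<^sub>i f) \<partial>\<^sub>j\<close>. If \<open>f = l h + l' h'\<close> with linear forms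
  \<open>l\<close>, \<open>l'\<close> and quadrics \<open>h\<close>, \<open>h'\<close>, there is an eleventh field: the one dual to the four-form
  \<open>dl \<and> dl' \<and> dh \<and> dh'\<close>. It annihilates \<open>l\<close>, \<open>l'\<close>, \<open>h\<close> and \<open>h'\<close>, hence \<open>f\<close>, its
  coefficients are quadratic because \<open>dl\<close> and \<open>dl'\<close> are constant, and it is divergence-free
  because the four-form is closed (\<open>slice_field_in_sl1\<close>, \<open>ruppert_slice_field\<close>).

  For special \<open>f\<close> these fields can be dependent, while for
  \<open>x\<^sub>0 x\<^sub>2 x\<^sub>3 + x\<^sub>1 x\<^sub>2 x\<^sub>4\<close> all eleven are independent (\<open>indep_family_model\<close>). An arbitrary
  \<open>f\<close> is therefore joined to this model by a polynomial curve. Minors are polynomials in the curve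
  parameter, so the annihilating fields are independent for all but finitely many parameters, and
  the rank drops below its value at \<open>f\<close> for finitely many parameters only; comparing both at a
  common parameter bounds the rank at \<open>f\<close> itself (\<open>ruppert_rank_bound_along_curve\<close>). This gives
  \<open>70 - 10 = 60\<close> for every cubic and \<open>70 - 11 = 59\<close> for slice rank at most two.

  The value \<open>60\<close> is attained at the Fermat cubic \<open>\<Sum>i. x\<^sub>i\<^sup>3\<close>: each of the \<open>60\<close> quartic monomials
  that have a square factor and are not fourth powers is, up to a scalar and fourth powers, the
  image of one divergence-free field (\<open>fermat_indep_family\<close>). Hence some minor of size \<open>60\<close> is
  nonzero there, and a minor, as the determinant of a matrix of linear forms in the coefficients of
  \<open>f\<close>, is a polynomial of degree \<open>60\<close>. Its nonvanishing defines the open set of the first claim.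
  All minors of size \<open>60\<close> vanish on the forms \<open>l h + l' h'\<close>, which include every point of a line
  spanned by two cubics with a linear factor, and so they vanish on the closure of the union of
  these lines (\<open>vanishes_on_secant\<close>).\<close>

section \<open>Families of vectors and their minors\<close>

text \<open>Families instead of sets: a family with a repeated member is dependent, and its indices can serve
  as the columns of a minor.\<close>

definition indep_family ::
  "('a::field \<Rightarrow> 'b::ab_group_add \<Rightarrow> 'b) \<Rightarrow> ('k::finite \<Rightarrow> 'b) \<Rightarrow> bool" where
  "indep_family s w \<longleftrightarrow> (\<forall>c. (\<Sum>j\<in>UNIV. s (c j) (w j)) = 0 \<longrightarrow> (\<forall>j. c j = 0))"

context
  fixes scale :: "'a::field \<Rightarrow> 'b::ab_group_add \<Rightarrow> 'b"
  assumes vector_space: "vector_space scale"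
begin

interpretation V: vector_space scale
  by (rule vector_space)

lemma indep_family_iff:
  fixes w :: "'k::finite \<Rightarrow> 'b"
  shows
  "indep_family scale w \<longleftrightarrow> inj w \<and> V.independent (range w)"
proof
  assume ind: "indep_family scale w"
  have inj: "inj w"
  proof (rule injI, rule ccontr)
    fix x y assume eq: "w x = w y" and ne: "x \<noteq> y"
    define c :: "'k \<Rightarrow> 'a" where "c = (\<lambda>j. if j = x then 1 else if j = y then - 1 else 0)"
    have "(\<Sum>j\<in>UNIV. scale (c j) (w j)) = (\<Sum>j\<in>{x, y}. scale (c j) (w j))"
      by (rule sum.mono_neutral_right) (auto simp: c_def V.scale_zero_left)
    also have "\<dots> = scale (c x) (w x) + scale (c y) (w y)"
      using ne by (subst sum.insert) auto
    also have "\<dots> = 0"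
      using ne by (simp add: c_def eq V.scale_one V.scale_minus_left)
    finally have "c x = 0"
      using ind unfolding indep_family_def by blast
    then show False
      by (simp add: c_def)
  qed
  moreover have "V.independent (range w)"
  proof (rule V.independent_if_scalars_zero)
    fix f x assume s: "(\<Sum>x\<in>range w. scale (f x) x) = 0" and x: "x \<in> range w"
    have "(\<Sum>j\<in>UNIV. scale (f (w j)) (w j)) = 0"
      using s by (simp add: sum.reindex[OF inj] o_def)
    then have "\<forall>j. f (w j) = 0"
      by (rule mp[OF spec[OF ind[unfolded indep_family_def], of "\<lambda>j. f (w j)"]])
    then show "f x = 0"
      using x by auto
  qed simp
  ultimately show "inj w \<and> V.independent (range w)" ..
next
  assume a: "inj w \<and> V.independent (range w)"
  show "indep_family scale w"
    unfolding indep_family_def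
  proof (intro allI impI)
    fix c j assume s: "(\<Sum>j\<in>UNIV. scale (c j) (w j)) = 0"
    have "(\<Sum>v\<in>range w. scale (c (inv w v)) v) = (\<Sum>j\<in>UNIV. scale (c j) (w j))"
      using a by (simp add: sum.reindex o_def)
    then have "c (inv w (w j)) = 0"
      using V.independentD[of "range w" "range w" "\<lambda>v. c (inv w v)" "w j"] a s by simp
    then show "c j = 0"
      using a by simp
  qed
qed

lemma card_le_dim_indep_family:
  fixes w :: "'k::finite \<Rightarrow> 'b"
  assumes "indep_family scale w" and "range w \<subseteq> V" and "V \<subseteq> V.span S" and "finite S"
  shows "CARD('k) \<le> V.dim V"
proof -
  obtain B where B: "B \<subseteq> V" "V.independent B" "V \<subseteq> V.span B" "card B = V.dim V"
    by (rule V.basis_exists)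
  have "finite B"
    using V.independent_span_bound[OF assms(4) B(2)] order_trans[OF B(1) assms(3)] by blast
  then have "card (range w) \<le> card B"
    using V.independent_span_bound[of B "range w"] order_trans[OF assms(2) B(3)] assms(1)
    unfolding indep_family_iff by blast
  then show ?thesis
    using assms(1)[THEN indep_family_iff[THEN iffD1]] B(4) card_image[of w UNIV] by linarith
qed

lemma indep_family_of_card_le:
  assumes "V.independent B" and "CARD('k::finite) \<le> card B"
  obtains w :: "'k::finite \<Rightarrow> 'b" where "indep_family scale w" and "range w \<subseteq> B"
proof -
  obtain T where T: "T \<subseteq> B" "card T = CARD('k)" "finite T"
    using obtain_subset_with_card_n[OF assms(2)] by blast
  then obtain w :: "'k \<Rightarrow> 'b" where w: "bij_betw w UNIV T"
    using finite_same_card_bij[of "UNIV :: 'k set" T] by auto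
  have "indep_family scale w"
    using w V.independent_mono[OF assms(1) T(1)] by (simp add: indep_family_iff bij_betw_def)
  then show ?thesis
    using that w T(1) by (simp add: bij_betw_def)
qed

lemma indep_family_of_dim:
  assumes "CARD('k::finite) \<le> V.dim V"
  obtains w :: "'k::finite \<Rightarrow> 'b" where "indep_family scale w" and "range w \<subseteq> V"
proof -
  obtain B where B: "B \<subseteq> V" "V.independent B" "card B = V.dim V"
    by (rule V.basis_exists)
  obtain w :: "'k \<Rightarrow> 'b" where "indep_family scale w" "range w \<subseteq> B"
    using indep_family_of_card_le[OF B(2)] assms B(3) by metis
  then show ?thesis
    using that B(1) by blast
qed

text \<open>A relation between the vectors is a relation between the columns of the matrix. The functionals are
  required to be linear on the span of the family only, which admits the coordinates with respect
  to a basis of a proper subspace.\<close>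

lemma det_nonzero_imp_indep_family:
  fixes w :: "'k::finite \<Rightarrow> 'b" and \<phi> :: "'k \<Rightarrow> 'b \<Rightarrow> 'a"
  assumes lin: "\<And>i c. \<phi> i (\<Sum>j\<in>UNIV. scale (c j) (w j)) = (\<Sum>j\<in>UNIV. c j * \<phi> i (w j))"
    and nz: "det (\<chi> i j. \<phi> i (w j)) \<noteq> 0"
  shows "indep_family scale w"
  unfolding indep_family_def
proof (intro allI impI)
  fix c j assume s: "(\<Sum>j\<in>UNIV. scale (c j) (w j)) = 0"
  let ?A = "(\<chi> i j. \<phi> i (w j)) :: 'a^'k^'k"
  have "(\<Sum>j\<in>UNIV. \<phi> i (w j) * c j) = 0" for i
    using lin[of i c] lin[of i "\<lambda>_. 0"] s by (simp add: mult.commute)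
  then have "?A *v (\<chi> j. c j) = 0"
    by (simp add: matrix_vector_mult_def vec_eq_iff)
  moreover have "\<exists>B. B ** ?A = mat 1"
    using nz by (simp add: invertible_det_nz[symmetric] invertible_left_inverse)
  ultimately have "(\<chi> j. c j) = (0 :: 'a^'k)"
    using matrix_left_invertible_ker[of ?A] by blast
  then show "c j = 0"
    by (simp add: vec_eq_iff)
qed

text \<open>Conversely, functionals dual to an independent family turn it into the identity matrix. Both
  directions together make independence a condition on minors, as the study of curves requires.\<close>

lemma dual_family:
  fixes w :: "'k::finite \<Rightarrow> 'b"
  assumes "indep_family scale w"
  obtains \<phi> :: "'k::finite \<Rightarrow> 'b \<Rightarrow> 'a" where
    "\<And>i. Vector_Spaces.linear scale (*) (\<phi> i)" and "\<And>i j. \<phi> i (w j) = (if i = j then 1 else 0)"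
proof -
  interpret vp: vector_space_pair scale "(*) :: 'a \<Rightarrow> 'a \<Rightarrow> 'a"
    by unfold_locales
  have w: "inj w" "V.independent (range w)"
    using assms by (auto simp: indep_family_iff)
  have "\<exists>g. Vector_Spaces.linear scale (*) g \<and> (\<forall>j. g (w j) = (if i = j then 1 else 0))" for i
  proof -
    obtain g where g: "Vector_Spaces.linear scale (*) g"
      "\<forall>x\<in>range w. g x = (if i = inv w x then 1 else 0)"
      using vp.linear_independent_extend[OF w(2), of "\<lambda>x. if i = inv w x then 1 else 0"] by blast
    then have "\<forall>j. g (w j) = (if i = j then 1 else 0)"
      using w(1) by simp
    then show ?thesis
      using g(1) by blast
  qed
  then obtain \<phi> where "\<And>i. Vector_Spaces.linear scale (*) (\<phi> i) \<and>
      (\<forall>j. \<phi> i (w j) = (if i = j then 1 else 0))"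
    by metis
  then show ?thesis
    using that by blast
qed

text \<open>Exchange turns an independent family into a nonzero minor: a basis that is
  completed from the family by members of \<open>C\<close> omits exactly as many members of \<open>C\<close> as the family
  has, and the coordinates of the family along the omitted ones form a nonsingular matrix.\<close>

lemma indep_family_imp_minor:
  fixes w :: "'k::finite \<Rightarrow> 'b"
  assumes ind: "indep_family scale w" and w: "range w \<subseteq> V.span C" and C: "V.independent C" "finite C"
  obtains r :: "'k::finite \<Rightarrow> 'b" where "inj r" and "range r \<subseteq> C"
    and "det (\<chi> i j. V.representation C (w j) (r i)) \<noteq> 0"
proof -
  have W: "inj w" "V.independent (range w)"
    using ind by (auto simp: indep_family_iff)
  obtain B where B: "range w \<subseteq> B" "B \<subseteq> range w \<union> C" "V.independent B" "range w \<union> C \<subseteq> V.span B"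
    using V.maximal_independent_subset_extend[of "range w" "range w \<union> C"] W(2) by auto
  (* The members of C that complete the family to a basis. *)
  define D where "D = B - range w"
  have D: "D \<subseteq> C" "finite D"
    using B(2) C(2) by (auto simp: D_def intro: finite_subset)
  have "finite B"
    using B(2) C(2) by (auto intro: finite_subset)
  have "V.span B = V.span C"
  proof
    show "V.span B \<subseteq> V.span C"
      using B(2) w V.span_superset[of C] by (intro V.span_minimal) auto
    show "V.span C \<subseteq> V.span B"
      using B(4) by (intro V.span_minimal) auto
  qed
  then have "card B = card C"
    using B(3) C(1) by (metis V.dim_span_eq_card_independent)
  moreover have "card B = CARD('k) + card D"
    using W(1) B(1) \<open>finite B\<close> card_mono[of B "range w"]
    by (simp add: D_def card_Diff_subset card_image)
  ultimately have "card (C - D) = CARD('k)"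
    using D card_Diff_subset[of D C] by simp
  then obtain r :: "'k \<Rightarrow> 'b" where r: "bij_betw r UNIV (C - D)"
    using C(2) finite_same_card_bij[of "UNIV :: 'k set" "C - D"] by auto
  have "det (\<chi> i j. V.representation C (w j) (r i)) \<noteq> 0"
  proof -
    let ?A = "(\<chi> i j. V.representation C (w j) (r i)) :: 'a^'k^'k"
    have "c = 0" if "?A *v c = 0" for c
    proof -
      define v where "v = (\<Sum>j\<in>UNIV. scale (c $ j) (w j))"
      have vC: "v \<in> V.span C"
        using w unfolding v_def by (intro V.span_sum V.span_scale) auto
      have rep: "V.representation C v b = (\<Sum>j\<in>UNIV. c $ j * V.representation C (w j) b)" for b
        unfolding v_def using w C(1)
        by (subst V.representation_sum)
          (auto intro!: V.span_scale sum.cong simp: V.representation_scale subset_iff)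
      have "V.representation C v b = 0" if "b \<in> C - D" for b
      proof -
        obtain i where "b = r i"
          using r \<open>b \<in> C - D\<close> by (auto simp: bij_betw_def)
        have "(?A *v c) $ i = 0"
          using \<open>?A *v c = 0\<close> by simp
        then show ?thesis
          by (simp add: rep \<open>b = r i\<close> matrix_vector_mult_def mult.commute)
      qed
      then have "(\<Sum>b\<in>C. scale (V.representation C v b) b) = (\<Sum>b\<in>D. scale (V.representation C v b) b)"
        using C(2) D by (intro sum.mono_neutral_right) auto
      then have "v = (\<Sum>b\<in>D. scale (V.representation C v b) b)"
        using V.sum_representation_eq[OF C(1) vC C(2)] by simp
      then have "(\<Sum>b\<in>range w. scale (c $ inv w b) b) = (\<Sum>b\<in>D. scale (V.representation C v b) b)"
        using W(1) unfolding v_def by (simp add: sum.reindex o_def)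
      then have "(\<Sum>b\<in>B. scale (if b \<in> range w then c $ inv w b else - V.representation C v b) b) = 0"
        using B(1) \<open>finite B\<close> unfolding D_def
        by (subst sum.subset_diff[of "range w" B])
          (auto simp: sum_negf V.scale_minus_left intro!: sum.cong)
      then have "(if b \<in> range w then c $ inv w b else - V.representation C v b) = 0" if "b \<in> B" for b
        by (rule V.independentD[OF B(3) \<open>finite B\<close> order_refl _ that])
      then have "c $ j = 0" for j
        using B(1) W(1) by (metis inv_f_f rangeI subset_iff)
      then show ?thesis
        by (simp add: vec_eq_iff)
    qed
    then show ?thesis
      by (simp add: invertible_det_nz[symmetric] invertible_left_inverse matrix_left_invertible_ker)
  qed
  then show ?thesis
    using that r by (auto simp: bij_betw_def)
qed

end

lemma indep_family_comp:
  assumes "vector_space s" and "indep_family s w" and "inj e"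
  shows "indep_family s (\<lambda>x. w (e x))"
proof -
  interpret V: vector_space s by (rule assms(1))
  have w: "inj w" "V.independent (range w)"
    using assms(2) indep_family_iff[OF assms(1), of w] by auto
  have "V.independent (range (\<lambda>x. w (e x)))"
    by (rule V.independent_mono[OF w(2)]) auto
  moreover have "inj (\<lambda>x. w (e x))"
    using w(1) assms(3) by (simp add: inj_def)
  ultimately show ?thesis
    using indep_family_iff[OF assms(1)] by blast
qed

section \<open>Polynomial curves in a vector space\<close>

text \<open>Curves with polynomial coordinates. Generating them by constants, sums and multiplication with the
  parameter needs neither a basis nor a bound for the degree, and makes stability under linear and
  bilinear maps a plain induction.\<close>

inductive curve :: "('a::field \<Rightarrow> 'b::ab_group_add \<Rightarrow> 'b) \<Rightarrow> ('a \<Rightarrow> 'b) \<Rightarrow> bool"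
  for scale where
  const: "curve scale (\<lambda>t. v)"
| add: "curve scale u \<Longrightarrow> curve scale w \<Longrightarrow> curve scale (\<lambda>t. u t + w t)"
| scale: "curve scale u \<Longrightarrow> curve scale (\<lambda>t. scale t (u t))"

lemma curve_sum: "(\<And>i. i \<in> A \<Longrightarrow> curve s (u i)) \<Longrightarrow> curve s (\<lambda>t. \<Sum>i\<in>A. u i t)"
  by (induction A rule: infinite_finite_induct) (auto intro: curve.intros)

lemma curve_linear_image:
  assumes "Vector_Spaces.linear s1 s2 \<phi>" and "curve s1 u"
  shows "curve s2 (\<lambda>t. \<phi> (u t))"
proof -
  interpret Vector_Spaces.linear s1 s2 \<phi> by (rule assms(1))
  show ?thesis
    using assms(2)
    by induction (simp_all add: add scale curve.const curve.add curve.scale[where scale = s2])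
qed

lemma curve_bilinear:
  assumes lin1: "\<And>y. Vector_Spaces.linear s1 s3 (\<lambda>x. b x y)"
    and lin2: "\<And>x. Vector_Spaces.linear s2 s3 (b x)"
    and "curve s1 u" and "curve s2 w"
  shows "curve s3 (\<lambda>t. b (u t) (w t))"
  using assms(3)
proof induction
  case (const v)
  show ?case
    by (rule curve_linear_image[OF lin2 assms(4)])
next
  case (add u u')
  interpret L: Vector_Spaces.linear s1 s3 "\<lambda>x. b x y" for y by (rule lin1)
  show ?case
    using add by (simp add: L.add curve.add)
next
  case (scale u)
  interpret L: Vector_Spaces.linear s1 s3 "\<lambda>x. b x y" for y by (rule lin1)
  show ?case
    using scale by (simp add: L.scale curve.scale[where scale = s3])
qed

lemma curve_segment: "curve s (\<lambda>t. v + s t (w - v))"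
  by (intro curve.intros)

text \<open>Scalar curves are polynomial functions, so that they have finitely many roots.\<close>

lemma curve_scalar_eq_poly:
  assumes "curve (*) \<phi>"
  obtains p where "\<phi> = poly p"
proof -
  have "\<exists>p. \<phi> = poly p"
    using assms
  proof induction
    case (const v)
    show ?case by (rule exI[of _ "[:v:]"]) auto
  next
    case (add u w)
    then obtain p q where "u = poly p" "w = poly q" by blast
    then show ?case by (intro exI[of _ "p + q"]) auto
  next
    case (scale u)
    then obtain p where "u = poly p" by blast
    then show ?case by (intro exI[of _ "pCons 0 p"]) auto
  qed
  then show ?thesis using that by blast
qed

lemma curve_scalar_poly:
  fixes p :: "'a::field poly"
  shows "curve (*) (\<lambda>t. poly p t)"
  by (induction p) (simp_all add: curve.const curve.add curve.scale[where scale = "(*)"])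

lemma curve_scalar_mult:
  assumes "curve (*) \<phi>" and "curve (*) \<psi>"
  shows "curve (*) (\<lambda>t. \<phi> t * \<psi> t :: 'a::field)"
proof -
  obtain p q where "\<phi> = poly p" "\<psi> = poly q"
    using assms curve_scalar_eq_poly by metis
  then have "(\<lambda>t. \<phi> t * \<psi> t) = poly (p * q)" by auto
  then show ?thesis by (metis curve_scalar_poly)
qed

lemma curve_scalar_prod:
  "(\<And>i. i \<in> A \<Longrightarrow> curve (*) (u i)) \<Longrightarrow> curve (*) (\<lambda>t. \<Prod>i\<in>A. u i t :: 'a::field)"
  by (induction A rule: infinite_finite_induct) (auto intro: curve.const curve_scalar_mult)

lemma curve_det:
  fixes A :: "'a::field \<Rightarrow> 'a^'k::finite^'k"
  assumes "\<And>i j. curve (*) (\<lambda>t. A t $ i $ j)"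
  shows "curve (*) (\<lambda>t. det (A t))"
  unfolding det_def
  by (intro curve_sum curve_scalar_mult curve_scalar_prod curve.const assms)

text \<open>A minor that is nonzero at one parameter is a nonzero polynomial in the parameter.\<close>

lemma finite_dependent_parameters:
  fixes w :: "'k::finite \<Rightarrow> 'a::field \<Rightarrow> 'b::ab_group_add"
  assumes "vector_space s"
    and ind: "indep_family s (\<lambda>j. w j t\<^sub>0)" and cur: "\<And>j. curve s (w j)"
  shows "finite {t. \<not> indep_family s (\<lambda>j. w j t)}"
proof -
  obtain \<phi> :: "'k \<Rightarrow> 'b \<Rightarrow> 'a" where
    lin: "\<And>i. Vector_Spaces.linear s (*) (\<phi> i)" and
    dual: "\<And>i j. \<phi> i (w j t\<^sub>0) = (if i = j then 1 else 0)"
    using dual_family[OF assms(1) ind] by blast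
  let ?A = "\<lambda>t. (\<chi> i j. \<phi> i (w j t)) :: 'a^'k^'k"
  have "curve (*) (\<lambda>t. det (?A t))"
    by (rule curve_det) (simp add: curve_linear_image[OF lin cur])
  then obtain p where p: "(\<lambda>t. det (?A t)) = poly p"
    by (rule curve_scalar_eq_poly)
  have "?A t\<^sub>0 = mat 1"
    by (simp add: dual mat_def)
  then have "poly p t\<^sub>0 = 1"
    using fun_cong[OF p, of t\<^sub>0] det_I[where 'a = 'a and 'n = 'k] by simp
  then have "finite {t. poly p t = 0}"
    by (intro poly_roots_finite) auto
  moreover have "indep_family s (\<lambda>j. w j t)" if "poly p t \<noteq> 0" for t
  proof (rule det_nonzero_imp_indep_family[OF assms(1), where \<phi> = \<phi>])
    interpret L: Vector_Spaces.linear s "(*)" "\<phi> i" for i by (rule lin)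
    show "\<phi> i (\<Sum>j\<in>UNIV. s (c j) (w j t)) = (\<Sum>j\<in>UNIV. c j * \<phi> i (w j t))" for i c
      by (simp add: L.sum L.scale)
    show "det (\<chi> i j. \<phi> i (w j t)) \<noteq> 0"
      using fun_cong[OF p, of t] that by simp
  qed
  then have "{t. \<not> indep_family s (\<lambda>j. w j t)} \<subseteq> {t. poly p t = 0}"
    by blast
  ultimately show ?thesis
    by (rule rev_finite_subset)
qed

section \<open>Arithmetic of polynomials\<close>

abbreviation "lookup \<equiv> Poly_Mapping.lookup"
abbreviation "single \<equiv> Poly_Mapping.single"

lemma poly_mapping_sum_single: "(\<Sum>k\<in>Poly_Mapping.keys p. single k (lookup p k)) = p"
proof (rule poly_mapping_eqI)
  fix m
  have "lookup (\<Sum>k\<in>Poly_Mapping.keys p. single k (lookup p k)) m =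
      (\<Sum>k\<in>Poly_Mapping.keys p. if k = m then lookup p m else 0)"
    by (simp add: lookup_sum lookup_single when_def if_distrib cong: if_cong)
  then show "lookup (\<Sum>k\<in>Poly_Mapping.keys p. single k (lookup p k)) m = lookup p m"
    by (simp add: in_keys_iff)
qed

lemma poly_mapping_induct_single [case_names zero single add]:
  fixes p :: "'a \<Rightarrow>\<^sub>0 'b::comm_monoid_add"
  assumes "P 0" and "\<And>k c. P (single k c)" and "\<And>p q. P p \<Longrightarrow> P q \<Longrightarrow> P (p + q)"
  shows "P p"
proof -
  have "P (\<Sum>k\<in>A. single k (lookup p k))" for A
    by (induction A rule: infinite_finite_induct) (auto intro: assms)
  then show ?thesis
    by (metis poly_mapping_sum_single)
qed

lemma lookup_smul [simp]: "lookup (smul c p) m = c * lookup p m"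
proof -
  have "smul c p = Poly_Mapping.map ((*) c) p"
    by (simp add: smul_def mult_map_scale_conv_mult)
  then show ?thesis
    by (simp add: Poly_Mapping.map.rep_eq when_def)
qed

lemma smul_single [simp]: "smul c (single m d) = single m (c * d)"
  by (simp add: smul_def mult_single)

lemma smul_mult_left: "smul c p * q = smul c (p * q)"
  by (simp add: smul_def mult.assoc)

lemma smul_mult_right: "p * smul c q = smul c (p * q)"
  by (simp add: smul_def mult.left_commute)

lemma mdeg_eq_sum:
  assumes "finite A" and "Poly_Mapping.keys m \<subseteq> A"
  shows "mdeg m = (\<Sum>v\<in>A. lookup m v)"
  unfolding mdeg_def using assms by (intro sum.mono_neutral_left) (auto simp: in_keys_iff)

lemma mdeg_eq_sum_UNIV: "mdeg (m :: 'v::finite \<Rightarrow>\<^sub>0 nat) = (\<Sum>v\<in>UNIV. lookup m v)"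
  by (rule mdeg_eq_sum) auto

lemma mdeg_zero [simp]: "mdeg 0 = 0"
  by (simp add: mdeg_def)

lemma mdeg_single [simp]: "mdeg (single v k) = k"
  by (simp add: mdeg_def)

lemma mdeg_add [simp]: "mdeg (a + b) = mdeg a + mdeg b"
proof -
  let ?A = "Poly_Mapping.keys a \<union> Poly_Mapping.keys b"
  have "mdeg (a + b) = (\<Sum>v\<in>?A. lookup (a + b) v)"
    by (rule mdeg_eq_sum) (auto simp: keys_add)
  moreover have "mdeg a = (\<Sum>v\<in>?A. lookup a v)" "mdeg b = (\<Sum>v\<in>?A. lookup b v)"
    by (rule mdeg_eq_sum; auto)+
  ultimately show ?thesis
    by (simp add: lookup_add sum.distrib)
qed

lemma forms_iff_lookup: "p \<in> forms d \<longleftrightarrow> (\<forall>m. lookup p m \<noteq> 0 \<longrightarrow> mdeg m = d)"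
  by (auto simp: forms_def in_keys_iff)

lemma forms_zero [simp]: "0 \<in> forms d"
  by (simp add: forms_iff_lookup)

lemma forms_add: "p \<in> forms d \<Longrightarrow> q \<in> forms d \<Longrightarrow> p + q \<in> forms d"
  unfolding forms_iff_lookup by (metis add.left_neutral lookup_add)

lemma forms_smul: "p \<in> forms d \<Longrightarrow> smul c p \<in> forms d"
  by (simp add: forms_iff_lookup)

lemma forms_diff: "p \<in> forms d \<Longrightarrow> q \<in> forms d \<Longrightarrow> p - q \<in> forms d"
  unfolding forms_iff_lookup by (metis diff_zero lookup_minus)

lemma forms_uminus: "p \<in> forms d \<Longrightarrow> - p \<in> forms d"
  by (simp add: forms_iff_lookup)

lemma forms_segment:
  assumes "p \<in> forms d" and "q \<in> forms d"
  shows "p + smul t (q - p) \<in> forms d"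
  using assms by (intro forms_add forms_smul forms_diff)

lemma forms_sum: "(\<And>i. i \<in> A \<Longrightarrow> p i \<in> forms d) \<Longrightarrow> (\<Sum>i\<in>A. p i) \<in> forms d"
  by (induction A rule: infinite_finite_induct) (auto intro: forms_add)

lemma forms_single: "mdeg m = d \<Longrightarrow> single m c \<in> forms d"
  by (simp add: forms_def)

lemma forms_mult:
  assumes "p \<in> forms a" and "q \<in> forms b"
  shows "p * q \<in> forms (a + b)"
  using assms keys_mult[of p q] by (fastforce simp: forms_def)

lemma subspace_forms: "mpoly.subspace (forms d)"
  by (auto simp: mpoly.subspace_def forms_add forms_smul)

lemma forms_prod:
  "finite A \<Longrightarrow> (\<And>i. i \<in> A \<Longrightarrow> p i \<in> forms 1) \<Longrightarrow> (\<Prod>i\<in>A. p i) \<in> forms (card A)"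
proof (induction A rule: finite_induct)
  case empty
  show ?case using forms_single[of 0 0 1] by simp
next
  case (insert x A)
  then have "p x * (\<Prod>i\<in>A. p i) \<in> forms (1 + card A)"
    by (intro forms_mult) auto
  then show ?case using insert by simp
qed

subsection \<open>Partial derivatives\<close>

text \<open>The coefficients of a derivative are the form in which linearity of differentiation and the symmetry
  of second derivatives become immediate.\<close>

lemma lookup_pdiff:
  "lookup (pdiff i p) m = of_nat (lookup m i + 1) * lookup p (m + single i 1)"
proof -
  have shift: "k = m + single i 1" if "k - single i 1 = m" "lookup k i \<noteq> 0" for k :: "'a \<Rightarrow>\<^sub>0 nat"
  proof (rule poly_mapping_eqI)
    fix v
    have "lookup m v = lookup k v - (1 when i = v)"
      using that(1) by (metis lookup_minus lookup_single)
    then show "lookup k v = lookup (m + single i 1) v"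
      using that(2) by (cases "v = i") (auto simp: lookup_add lookup_single when_def)
  qed
  have "lookup (pdiff i p) m =
      (\<Sum>k\<in>Poly_Mapping.keys p. if k - single i 1 = m then of_nat (lookup k i) * lookup p k else 0)"
    unfolding pdiff_def lookup_sum lookup_single when_def ..
  also have "\<dots> = (\<Sum>k\<in>Poly_Mapping.keys p.
      if k = m + single i 1 then of_nat (lookup m i + 1) * lookup p (m + single i 1) else 0)"
  proof (rule sum.cong)
    fix k
    show "(if k - single i 1 = m then of_nat (lookup k i) * lookup p k else 0) =
      (if k = m + single i 1 then of_nat (lookup m i + 1) * lookup p (m + single i 1) else 0)"
    proof (cases "k = m + single i 1")
      case True
      then show ?thesis by (simp add: lookup_add del: One_nat_def)
    next
      case False
      then have "k - single i 1 \<noteq> m \<or> lookup k i = 0"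
        using shift[of k] by blast
      then show ?thesis using False by auto
    qed
  qed simp
  also have "\<dots> = of_nat (lookup m i + 1) * lookup p (m + single i 1)"
    by (simp add: in_keys_iff)
  finally show ?thesis .
qed

lemma pdiff_add: "pdiff i (p + q) = pdiff i p + pdiff i q"
  by (rule poly_mapping_eqI) (simp only: lookup_pdiff lookup_add distrib_left)

lemma pdiff_smul: "pdiff i (smul c p) = smul c (pdiff i p)"
  by (rule poly_mapping_eqI) (simp add: lookup_pdiff)

lemma linear_pdiff: "Vector_Spaces.linear smul smul (pdiff i)"
  by unfold_locales (simp_all add: pdiff_add pdiff_smul)

lemmas pdiff_zero [simp] = Vector_Spaces.linear.axioms(3)[OF linear_pdiff, THEN module_hom.zero]
lemmas pdiff_sum = Vector_Spaces.linear.axioms(3)[OF linear_pdiff, THEN module_hom.sum]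

lemma pdiff_commute: "pdiff i (pdiff j p) = pdiff j (pdiff i p)"
  by (rule poly_mapping_eqI)
    (auto simp: lookup_pdiff lookup_add lookup_single when_def add_ac)

lemma pdiff_single: "pdiff i (single m c) = single (m - single i 1) (of_nat (lookup m i) * c)"
  by (cases "c = 0") (simp_all add: pdiff_def)

text \<open>Both sides are biadditive, so monomials suffice. The truncated exponents cause no harm: where
  \<open>x\<^sub>i\<close> does not divide a monomial, its derivative has coefficient zero.\<close>

lemma pdiff_mult: "pdiff i (p * q) = pdiff i p * q + p * pdiff i q"
proof (induction p rule: poly_mapping_induct_single)
  case (single a c)
  show ?case
  proof (induction q rule: poly_mapping_induct_single)
    case (single b d)
    have shift: "single (a - single i 1 + b) (of_nat (lookup a i) * e) =
        single (a + b - single i 1) (of_nat (lookup a i) * e)" for a b :: "'a \<Rightarrow>\<^sub>0 nat" and e :: complex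
    proof (cases "lookup a i = 0")
      case False
      then have "a - single i 1 + b = a + b - single i 1"
        by (intro poly_mapping_eqI) (auto simp: lookup_add lookup_minus lookup_single when_def)
      then show ?thesis by simp
    qed simp
    show ?case
      using shift[of a b "c * d"] shift[of b a "c * d"]
      by (simp add: pdiff_single mult_single lookup_add distrib_left distrib_right single_add ac_simps)
  qed (simp_all add: pdiff_add distrib_left)
qed (simp_all add: pdiff_add distrib_right)

lemma forms_pdiff: "p \<in> forms (Suc d) \<Longrightarrow> pdiff i p \<in> forms d"
  by (fastforce simp: forms_iff_lookup lookup_pdiff)

subsection \<open>Evaluation\<close>

definition eval_monom :: "('v \<Rightarrow>\<^sub>0 nat) \<Rightarrow> ('v \<Rightarrow> complex) \<Rightarrow> complex" where
  "eval_monom m a = (\<Prod>v\<in>Poly_Mapping.keys m. a v ^ lookup m v)"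

lemma eval_monom_add: "eval_monom (m + n) a = eval_monom m a * eval_monom n a"
proof -
  let ?A = "Poly_Mapping.keys m \<union> Poly_Mapping.keys n"
  have ext: "eval_monom k a = (\<Prod>v\<in>?A. a v ^ lookup k v)" if "Poly_Mapping.keys k \<subseteq> ?A" for k
    unfolding eval_monom_def using that
    by (intro prod.mono_neutral_left) (auto simp: in_keys_iff)
  show ?thesis
    using keys_add[of m n]
    by (simp add: ext lookup_add power_add prod.distrib)
qed

lemma eval_mpoly_eq_sum:
  assumes "finite A" and "Poly_Mapping.keys p \<subseteq> A"
  shows "eval_mpoly p a = (\<Sum>m\<in>A. lookup p m * eval_monom m a)"
  unfolding eval_mpoly_def eval_monom_def[symmetric]
  using assms by (intro sum.mono_neutral_left) (auto simp: in_keys_iff)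

lemma eval_mpoly_zero [simp]: "eval_mpoly 0 a = 0"
  by (simp add: eval_mpoly_def)

lemma eval_mpoly_single: "eval_mpoly (single m c) a = c * eval_monom m a"
  by (subst eval_mpoly_eq_sum[of "{m}"]) auto

lemma eval_mpoly_add: "eval_mpoly (p + q) a = eval_mpoly p a + eval_mpoly q a"
proof -
  let ?A = "Poly_Mapping.keys p \<union> Poly_Mapping.keys q"
  have ext: "eval_mpoly k a = (\<Sum>m\<in>?A. lookup k m * eval_monom m a)" if "Poly_Mapping.keys k \<subseteq> ?A" for k
    by (rule eval_mpoly_eq_sum) (use that in auto)
  show ?thesis
    using keys_add[of p q] by (simp add: ext lookup_add distrib_right sum.distrib)
qed

lemma eval_mpoly_mult: "eval_mpoly (p * q) a = eval_mpoly p a * eval_mpoly q a"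
proof (induction p rule: poly_mapping_induct_single)
  case (single m c)
  show ?case
    by (induction q rule: poly_mapping_induct_single)
      (simp_all add: mult_single eval_mpoly_single eval_monom_add eval_mpoly_add distrib_left)
qed (simp_all add: eval_mpoly_add distrib_right)

lemma eval_mpoly_one [simp]: "eval_mpoly 1 a = 1"
  using eval_mpoly_single[of 0 1 a] by (simp add: eval_monom_def)

lemma eval_mpoly_minus: "eval_mpoly (- p) a = - eval_mpoly p a"
  using eval_mpoly_add[of p "- p" a] by (simp add: minus_unique)

lemma eval_mpoly_sum: "eval_mpoly (\<Sum>i\<in>A. p i) a = (\<Sum>i\<in>A. eval_mpoly (p i) a)"
  by (induction A rule: infinite_finite_induct) (simp_all add: eval_mpoly_add)

lemma eval_mpoly_prod: "eval_mpoly (\<Prod>i\<in>A. p i) a = (\<Prod>i\<in>A. eval_mpoly (p i) a)"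
  by (induction A rule: infinite_finite_induct) (simp_all add: eval_mpoly_mult)

lemma eval_mpoly_det:
  fixes A :: "'v mpoly^'k::finite^'k"
  shows "eval_mpoly (det A) a = det (\<chi> i j. eval_mpoly (A $ i $ j) a)"
proof -
  have sign: "eval_mpoly (of_int (sign \<pi>)) a = of_int (sign \<pi>)" for \<pi> :: "'k \<Rightarrow> 'k"
    by (auto simp: sign_def eval_mpoly_minus)
  show ?thesis
    unfolding det_def by (simp add: eval_mpoly_sum eval_mpoly_mult eval_mpoly_prod sign)
qed

lemma forms_det:
  fixes A :: "'v mpoly^'k::finite^'k"
  assumes "\<And>i j. A $ i $ j \<in> forms 1"
  shows "det A \<in> forms CARD('k)"
  unfolding det_def
proof (intro forms_sum)
  fix \<pi> :: "'k \<Rightarrow> 'k"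
  have "(\<Prod>i\<in>UNIV. A $ i $ \<pi> i) \<in> forms CARD('k)"
    using forms_prod[of UNIV "\<lambda>i. A $ i $ \<pi> i"] assms by simp
  then show "of_int (sign \<pi>) * (\<Prod>i\<in>UNIV. A $ i $ \<pi> i) \<in> forms CARD('k)"
    using forms_diff[of 0] by (auto simp: sign_def)
qed

section \<open>Divergence-free quadratic vector fields\<close>

subsection \<open>Monomials of a given degree\<close>

text \<open>A monomial is the list of its exponents, that is, a weak composition of the degree.\<close>

lemma card_monomials:
  "card {m :: 'v::finite \<Rightarrow>\<^sub>0 nat. mdeg m = d} = (d + CARD('v) - 1) choose d" (is ?card)
  and finite_monomials: "finite {m :: 'v::finite \<Rightarrow>\<^sub>0 nat. mdeg m = d}" (is ?fin)
proof -
  obtain vs :: "'v list" where vs: "set vs = UNIV" "distinct vs"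
    using finite_distinct_list[of "UNIV :: 'v set"] by auto
  then have len: "length vs = CARD('v)"
    by (metis distinct_card)
  let ?F = "\<lambda>m :: 'v \<Rightarrow>\<^sub>0 nat. map (lookup m) vs"
  let ?L = "{l :: nat list. length l = CARD('v) \<and> sum_list l = d}"
  have bij: "bij_betw ?F {m. mdeg m = d} ?L"
    unfolding bij_betw_def
  proof
    show "inj_on ?F {m. mdeg m = d}"
    proof (rule inj_onI)
      fix m n :: "'v \<Rightarrow>\<^sub>0 nat" assume "?F m = ?F n"
      then show "m = n"
        using vs by (intro poly_mapping_eqI) (simp add: map_eq_conv)
    qed
    show "?F ` {m. mdeg m = d} = ?L"
    proof (intro equalityI subsetI)
      fix l assume "l \<in> ?F ` {m. mdeg m = d}"
      then show "l \<in> ?L"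
        using vs len by (auto simp: sum_list_distinct_conv_sum_set mdeg_eq_sum_UNIV)
    next
      fix l assume l: "l \<in> ?L"
      define m where "m = (\<Sum>i<length vs. single (vs ! i) (l ! i))"
      have "lookup m (vs ! j) = l ! j" if "j < length vs" for j
      proof -
        have "lookup m (vs ! j) = (\<Sum>i<length vs. if i = j then l ! j else 0)"
          unfolding m_def lookup_sum lookup_single when_def
          using vs(2) that by (intro sum.cong) (auto simp: nth_eq_iff_index_eq)
        then show ?thesis using that by simp
      qed
      then have F: "?F m = l"
        using l len by (intro nth_equalityI) auto
      then have "mdeg m = d"
        using l vs by (metis (mono_tags, lifting) mdeg_eq_sum_UNIV mem_Collect_eq
            sum_list_distinct_conv_sum_set)
      then show "l \<in> ?F ` {m. mdeg m = d}"
        using F by force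
    qed
  qed
  show ?card
    using bij_betw_same_card[OF bij] by (simp add: card_length_sum_list)
  have "CARD('v) \<ge> 1"
    by (simp add: Suc_leI)
  then have "d \<le> d + CARD('v) - 1"
    by linarith
  then have "card ?L > 0"
    by (simp add: card_length_sum_list zero_less_binomial_iff)
  then have "finite ?L"
    by (rule card_ge_0_finite)
  then show ?fin
    using bij_betw_finite[OF bij] by blast
qed

lemma mdeg_eq_1_iff: "mdeg (m :: 'v::finite \<Rightarrow>\<^sub>0 nat) = 1 \<longleftrightarrow> (\<exists>j. m = single j 1)"
proof
  assume m: "mdeg m = 1"
  then obtain j where j: "lookup m j = 1" "\<forall>v\<in>UNIV. j \<noteq> v \<longrightarrow> lookup m v = 0"
    unfolding mdeg_eq_sum_UNIV using sum_eq_1_iff[of UNIV "lookup m"] by auto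
  then have "m = single j 1"
    by (intro poly_mapping_eqI) (auto simp: lookup_single when_def)
  then show "\<exists>j. m = single j 1" ..
qed auto

lemma form_eq_sum_monomials:
  fixes p :: "'v::finite mpoly"
  assumes "p \<in> forms d"
  shows "p = (\<Sum>m\<in>{m. mdeg m = d}. smul (lookup p m) (single m 1))"
proof (rule poly_mapping_eqI)
  fix k
  have "lookup (\<Sum>m\<in>{m. mdeg m = d}. smul (lookup p m) (single m 1)) k =
      (\<Sum>m\<in>{m. mdeg m = d}. if m = k then lookup p k else 0)"
    unfolding lookup_sum by (intro sum.cong) (auto simp: lookup_single when_def)
  then show "lookup p k = lookup (\<Sum>m\<in>{m. mdeg m = d}. smul (lookup p m) (single m 1)) k"
    using assms by (auto simp: finite_monomials forms_iff_lookup)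
qed

lemma linear_form_eq_sum:
  fixes p :: "'v::finite mpoly"
  assumes "p \<in> forms 1"
  shows "p = (\<Sum>j\<in>UNIV. single (single j 1) (lookup p (single j 1)))"
proof -
  have "{m :: 'v \<Rightarrow>\<^sub>0 nat. mdeg m = 1} = range (\<lambda>j. single j 1)"
    unfolding mdeg_eq_1_iff by auto
  moreover have "inj (\<lambda>j :: 'v. single j (1::nat))"
    by (rule injI) (metis keys_single singleton_inject zero_neq_one)
  ultimately show ?thesis
    using form_eq_sum_monomials[OF assms] by (simp add: sum.reindex o_def)
qed

subsection \<open>The projection onto divergence-free fields\<close>

lemma vmul_nth [simp]: "vmul c g $ i = smul c (g $ i)"
  by (simp add: vmul_def)

lemma linear_axis: "Vector_Spaces.linear smul vmul (axis i)"
  by unfold_locales (simp_all add: vmul_def vec_eq_iff axis_def)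

lemma linear_ruppert: "Vector_Spaces.linear vmul smul (ruppert f)"
  by unfold_locales
    (simp_all add: vmul_def ruppert_def distrib_right sum.distrib smul_mult_left mpoly.scale_sum_right)

lemma linear_ruppert_form: "Vector_Spaces.linear smul smul (\<lambda>f. ruppert f g)"
  by unfold_locales
    (simp_all add: ruppert_def pdiff_add pdiff_smul distrib_left sum.distrib smul_mult_right
      mpoly.scale_sum_right)

interpretation ruppert: Vector_Spaces.linear vmul smul "ruppert f" for f
  by (rule linear_ruppert)

lemma ruppert_axis: "ruppert f (axis i p) = p * pdiff i f"
proof -
  have "ruppert f (axis i p) = (\<Sum>k\<in>UNIV. if k = i then p * pdiff i f else 0)"
    unfolding ruppert_def by (intro sum.cong) (auto simp: axis_def)
  then show ?thesis by simp
qed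

definition divergence :: "form ^ 5 \<Rightarrow> form" where
  "divergence g = (\<Sum>i\<in>UNIV. pdiff i (g $ i))"

interpretation divergence: Vector_Spaces.linear vmul smul divergence
  by unfold_locales
    (simp_all add: divergence_def vmul_def pdiff_add pdiff_smul sum.distrib mpoly.scale_sum_right)

lemma divergence_axis: "divergence (axis i p) = pdiff i p"
proof -
  have "divergence (axis i p) = (\<Sum>k\<in>UNIV. if k = i then pdiff i p else 0)"
    unfolding divergence_def by (intro sum.cong) (auto simp: axis_def)
  then show ?thesis by simp
qed

lemma sl1_iff: "g \<in> sl1 \<longleftrightarrow> (\<forall>i. g $ i \<in> forms 2) \<and> divergence g = 0"
  by (simp add: sl1_def divergence_def)

lemma subspace_sl1: "vfield.subspace sl1"
  by (auto simp: vfield.subspace_def sl1_iff divergence.add divergence.scale forms_add forms_smul)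

text \<open>On quadratic fields, the projection onto the divergence-free ones along the span of the \<open>x\<^sub>j\<^sup>2 \<partial>\<^sub>j\<close>, whose
  divergences \<open>2 x\<^sub>j\<close> form a basis of the linear forms.\<close>

definition div_free_part :: "form ^ 5 \<Rightarrow> form ^ 5" where
  "div_free_part g = g - (\<Sum>j\<in>UNIV. axis j (smul (lookup (divergence g) (single j 1) / 2)
     (single (single j 2) 1)))"

interpretation div_free_part: Vector_Spaces.linear vmul vmul div_free_part
proof unfold_locales
  interpret A: Vector_Spaces.linear smul vmul "axis j" for j :: 5 by (rule linear_axis)
  fix g h :: "form ^ 5" and c
  show "div_free_part (g + h) = div_free_part g + div_free_part h"
    by (simp add: div_free_part_def divergence.add lookup_add add_divide_distrib
        single_add A.add sum.distrib)
  show "div_free_part (vmul c g) = vmul c (div_free_part g)"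
    unfolding div_free_part_def divergence.scale lookup_smul vfield.scale_right_diff_distrib
      vfield.scale_sum_right A.scale[symmetric] mpoly.scale_scale times_divide_eq_right ..
qed

lemma div_free_part_sl1: "g \<in> sl1 \<Longrightarrow> div_free_part g = g"
  by (simp add: div_free_part_def sl1_iff axis_def zero_vec_def)

lemma div_free_part_in_sl1:
  assumes "\<And>i. g $ i \<in> forms 2"
  shows "div_free_part g \<in> sl1"
  unfolding sl1_iff
proof
  show "\<forall>i. div_free_part g $ i \<in> forms 2"
    unfolding div_free_part_def
    by (auto intro!: forms_diff forms_sum assms simp: axis_def forms_single)
  have "divergence g \<in> forms 1"
    unfolding divergence_def using assms
    by (intro forms_sum forms_pdiff) (simp add: numeral_2_eq_2)
  then have *: "divergence g = (\<Sum>j\<in>UNIV. single (single j 1) (lookup (divergence g) (single j 1)))"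
    by (rule linear_form_eq_sum)
  have sq: "single j 2 - single j 1 = single j (1::nat)" for j :: 5
    by (simp add: single_diff[symmetric])
  have "divergence (div_free_part g) = divergence g -
      (\<Sum>j\<in>UNIV. single (single j 1) (lookup (divergence g) (single j 1)))"
    unfolding div_free_part_def divergence.diff divergence.sum divergence_axis
    by (simp add: pdiff_single sq[simplified])
  then show "divergence (div_free_part g) = 0"
    using * by simp
qed

text \<open>A divergence-free field is determined by its coefficients other than those of
  \<open>x\<^sub>i\<^sup>2 \<partial>\<^sub>i\<close>, since the vanishing divergence expresses the latter through the others. This
  leaves \<open>75 - 5\<close> generators.\<close>

lemma sl1_spanned_by_70:
  obtains S where "finite S" and "card S \<le> 70" and "sl1 \<subseteq> vfield.span S"
proof -
  define M :: "5 \<Rightarrow> (5 \<Rightarrow>\<^sub>0 nat) set" where "M = (\<lambda>i. {m. mdeg m = 2} - {single i 2})"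
  define G where "G = (\<lambda>(i :: 5, m :: 5 \<Rightarrow>\<^sub>0 nat). div_free_part (axis i (single m 1)))"
  have card_2: "card {m :: 5 \<Rightarrow>\<^sub>0 nat. mdeg m = 2} = 15"
    by (simp add: card_monomials choose_two)
  have card_M: "card (M i) = 14" for i
    using card_Diff_singleton[of "single i 2" "{m. mdeg m = 2}"]
    unfolding M_def card_2 by simp
  have fin_M: "finite (M i)" for i
    by (simp add: M_def finite_monomials)
  then have fin: "finite (Sigma UNIV M)"
    by (intro finite_SigmaI) auto
  have "card (Sigma UNIV M) = 70"
    using fin_M by (simp add: card_M)
  then have "card (G ` Sigma UNIV M) \<le> 70"
    using card_image_le[OF fin, of G] by simp
  moreover have "g \<in> vfield.span (G ` Sigma UNIV M)" if g: "g \<in> sl1" for g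
  proof -
    interpret A: Vector_Spaces.linear smul vmul "axis j" for j :: 5 by (rule linear_axis)
    have "g = (\<Sum>i\<in>UNIV. axis i (g $ i))"
      by (simp add: vec_eq_iff axis_def)
    also have "\<dots> = (\<Sum>i\<in>UNIV. axis i (\<Sum>m\<in>{m. mdeg m = 2}. smul (lookup (g $ i) m) (single m 1)))"
      using g by (intro sum.cong refl arg_cong[of _ _ "axis _"] form_eq_sum_monomials)
        (simp add: sl1_iff)
    finally have "div_free_part g =
        (\<Sum>i\<in>UNIV. \<Sum>m\<in>{m. mdeg m = 2}. vmul (lookup (g $ i) m) (G (i, m)))"
      unfolding G_def prod.case by (metis (no_types, lifting) A.scale A.sum div_free_part.scale
          div_free_part.sum sum.cong)
    moreover have "G (i, m) \<in> vfield.span (G ` Sigma UNIV M)" if "mdeg m = 2" for i m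
    (* The excluded generators are annihilated by the projection. *)
    proof (cases "m = single i 2")
      case True
      have sq: "single i 2 - single i 1 = single i (1::nat)"
        by (simp add: single_diff[symmetric])
      have "lookup (divergence (axis i (single m 1))) (single j 1) / 2 = (if j = i then 1 else 0)" for j
        using True sq by (auto simp: divergence_axis pdiff_single lookup_single when_def
            dest: arg_cong[of _ _ Poly_Mapping.keys])
      then have "(\<Sum>j\<in>UNIV. axis j (smul (lookup (divergence (axis i (single m 1))) (single j 1) / 2)
          (single (single j 2) 1))) = axis i (single m 1)"
        by (simp only:) (simp add: True vec_eq_iff axis_def)
      then have "G (i, m) = 0"
        by (simp add: G_def div_free_part_def)
      then show ?thesis
        by (simp add: vfield.span_zero)
    next
      case False
      then show ?thesis
        using that by (intro vfield.span_base imageI) (auto simp: M_def)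
    qed
    then have "(\<Sum>i\<in>UNIV. \<Sum>m\<in>{m. mdeg m = 2}. vmul (lookup (g $ i) m) (G (i, m)))
        \<in> vfield.span (G ` Sigma UNIV M)"
      by (intro vfield.span_sum vfield.span_scale) simp
    ultimately show ?thesis
      using div_free_part_sl1[OF g] by simp
  qed
  ultimately show ?thesis
    using that[of "G ` Sigma UNIV M"] fin by blast
qed

text \<open>Extend the annihilated family to a basis of the source; only the other basis vectors contribute to
  the image.\<close>

lemma ruppert_rank_nullity_le:
  fixes K :: "'k::finite \<Rightarrow> form ^ 5"
  assumes ind: "indep_family vmul K" and sl: "range K \<subseteq> sl1" and ker: "\<And>x. ruppert f (K x) = 0"
  shows "ruppert_rank f + CARD('k) \<le> 70"
proof -
  have K: "inj K" "vfield.independent (range K)"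
    using ind indep_family_iff[OF vfield.vector_space_axioms, of K] by auto
  obtain B where B: "range K \<subseteq> B" "B \<subseteq> sl1" "vfield.independent B" "sl1 \<subseteq> vfield.span B"
    using vfield.maximal_independent_subset_extend[OF sl K(2)] by blast
  obtain S where S: "finite S" "card S \<le> 70" "sl1 \<subseteq> vfield.span S"
    by (rule sl1_spanned_by_70)
  have cB: "finite B" "card B \<le> 70"
    using vfield.independent_span_bound[OF S(1) B(3) order_trans[OF B(2) S(3)]] S(2) by auto
  have "ruppert f ` sl1 \<subseteq> ruppert f ` vfield.span B"
    using B(4) by blast
  also have "\<dots> = mpoly.span (ruppert f ` B)"
    by (simp add: ruppert.span_image)
  also have "\<dots> \<subseteq> mpoly.span (ruppert f ` (B - range K))"
  proof (rule mpoly.span_minimal)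
    have "ruppert f b \<in> mpoly.span (ruppert f ` (B - range K))" if "b \<in> B" for b
      using that ker by (cases "b \<in> range K") (auto intro: mpoly.span_base mpoly.span_zero)
    then show "ruppert f ` B \<subseteq> mpoly.span (ruppert f ` (B - range K))"
      by blast
  qed simp
  finally have "ruppert_rank f \<le> card (ruppert f ` (B - range K))"
    unfolding ruppert_rank_def using cB by (intro mpoly.dim_le_card) auto
  also have "\<dots> \<le> card (B - range K)"
    using cB by (intro card_image_le) auto
  also have "\<dots> = card B - CARD('k)"
    using B(1) K(1) by (simp add: card_Diff_subset card_image)
  finally have "ruppert_rank f \<le> card B - CARD('k)" .
  moreover have "CARD('k) \<le> card B"
    using card_mono[OF cB(1) B(1)] K(1) by (simp add: card_image)
  ultimately show ?thesis
    using cB(2) by simp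
qed

lemma ruppert_in_forms:
  assumes "f \<in> forms 3" and "g \<in> sl1"
  shows "ruppert f g \<in> forms 4"
proof -
  have "g $ i * pdiff i f \<in> forms (2 + 2)" for i
    using assms by (intro forms_mult forms_pdiff) (auto simp: sl1_iff numeral_3_eq_3)
  then show ?thesis
    unfolding ruppert_def by (intro forms_sum) simp
qed

lemma forms_finite_span:
  "(forms d :: 'v::finite mpoly set) \<subseteq> mpoly.span ((\<lambda>m. single m 1) ` {m. mdeg m = d})"
proof
  fix p :: "'v mpoly" assume "p \<in> forms d"
  moreover have "(\<Sum>m\<in>{m. mdeg m = d}. smul (lookup p m) (single m 1))
      \<in> mpoly.span ((\<lambda>m. single m 1) ` {m. mdeg m = d})"
    by (intro mpoly.span_sum mpoly.span_scale mpoly.span_base imageI) auto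
  ultimately show "p \<in> mpoly.span ((\<lambda>m. single m 1) ` {m. mdeg m = d})"
    using form_eq_sum_monomials[of p d] by simp
qed

section \<open>Polynomial curves of vector fields\<close>

lemma linear_mult_left: "Vector_Spaces.linear smul smul (\<lambda>p. p * q)"
  by unfold_locales (simp_all add: distrib_right smul_mult_left)

lemma linear_mult_right: "Vector_Spaces.linear smul smul (\<lambda>q. p * q)"
  by unfold_locales (simp_all add: distrib_left smul_mult_right)

lemma linear_smul_left: "Vector_Spaces.linear (*) smul (\<lambda>c. smul c p)"
  by unfold_locales (simp_all add: mpoly.scale_left_distrib)

lemma linear_smul_right: "Vector_Spaces.linear smul smul (smul c)"
  by unfold_locales (simp_all add: mpoly.scale_right_distrib mpoly.scale_left_commute)

lemma linear_lookup: "Vector_Spaces.linear smul (*) (\<lambda>p. lookup p m)"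
  by unfold_locales (simp_all add: lookup_add algebra_simps)

lemma curve_mult: "curve smul u \<Longrightarrow> curve smul w \<Longrightarrow> curve smul (\<lambda>t. u t * w t)"
  by (rule curve_bilinear[OF linear_mult_left linear_mult_right])

lemma curve_smul: "curve (*) c \<Longrightarrow> curve smul w \<Longrightarrow> curve smul (\<lambda>t. smul (c t) (w t))"
  by (rule curve_bilinear[OF linear_smul_left linear_smul_right])

lemma curve_pdiff: "curve smul u \<Longrightarrow> curve smul (\<lambda>t. pdiff i (u t))"
  by (rule curve_linear_image[OF linear_pdiff])

lemma curve_lookup: "curve smul u \<Longrightarrow> curve (*) (\<lambda>t. lookup (u t) m)"
  by (rule curve_linear_image[OF linear_lookup])

lemma curve_axis: "curve smul u \<Longrightarrow> curve vmul (\<lambda>t. axis i (u t))"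
  by (rule curve_linear_image[OF linear_axis])

lemma curve_diff:
  assumes "vector_space s" and "curve s u" and "curve s w"
  shows "curve s (\<lambda>t. u t - w t)"
proof -
  interpret V: vector_space s by (rule assms(1))
  have "Vector_Spaces.linear s s uminus"
    by unfold_locales (simp_all add: V.scale_minus_right)
  then have "curve s (\<lambda>t. u t + - w t)"
    using assms by (intro curve.add curve_linear_image[of s s uminus])
  then show ?thesis by simp
qed

lemma curve_vec:
  assumes "\<And>i. curve smul (\<lambda>t. g t $ i)"
  shows "curve vmul g"
proof -
  have "curve vmul (\<lambda>t. \<Sum>i\<in>UNIV. axis i (g t $ i))"
    by (intro curve_sum curve_axis assms)
  moreover have "(\<Sum>i\<in>UNIV. axis i (g t $ i)) = g t" for t
    by (simp add: vec_eq_iff axis_def)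
  ultimately show ?thesis by simp
qed

text \<open>Semicontinuity in both directions: independence of the kernel family and of a family of
  values of the Ruppert map can each fail for finitely many parameters only, so that some
  parameter serves both.\<close>

lemma ruppert_rank_bound_along_curve:
  fixes K :: "'k::finite \<Rightarrow> complex \<Rightarrow> form ^ 5"
  assumes F: "curve smul F" "\<And>t. F t \<in> forms 3"
    and K: "\<And>x. curve vmul (K x)" "\<And>x t. K x t \<in> sl1" "\<And>x t. ruppert (F t) (K x t) = 0"
    and ind: "indep_family vmul (\<lambda>x. K x t\<^sub>1)"
    and rank: "CARD('n::finite) \<le> ruppert_rank (F t\<^sub>0)"
  shows "CARD('n) + CARD('k) \<le> 70"
proof -
  obtain w :: "'n \<Rightarrow> form" where w: "indep_family smul w" "range w \<subseteq> ruppert (F t\<^sub>0) ` sl1"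
    using indep_family_of_dim[OF mpoly.vector_space_axioms] rank unfolding ruppert_rank_def by blast
  then have "\<forall>j. \<exists>g\<in>sl1. w j = ruppert (F t\<^sub>0) g"
    by blast
  then obtain g where g: "\<And>j. g j \<in> sl1" "\<And>j. w j = ruppert (F t\<^sub>0) (g j)"
    by metis
  have "finite {t. \<not> indep_family smul (\<lambda>j. ruppert (F t) (g j))}"
    using w(1) unfolding g(2)[abs_def]
    by (rule finite_dependent_parameters[OF mpoly.vector_space_axioms])
      (rule curve_linear_image[OF linear_ruppert_form F(1)])
  moreover have "finite {t. \<not> indep_family vmul (\<lambda>x. K x t)}"
    using ind K(1) by (rule finite_dependent_parameters[OF vfield.vector_space_axioms])
  ultimately have "finite ({t. \<not> indep_family smul (\<lambda>j. ruppert (F t) (g j))} \<union>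
      {t. \<not> indep_family vmul (\<lambda>x. K x t)})"
    by blast
  then obtain t where t: "indep_family smul (\<lambda>j. ruppert (F t) (g j))"
    "indep_family vmul (\<lambda>x. K x t)"
    using ex_new_if_finite[OF infinite_UNIV_char_0[where 'a = complex]] by blast
  have "CARD('n) \<le> ruppert_rank (F t)"
    unfolding ruppert_rank_def
  proof (rule card_le_dim_indep_family[OF mpoly.vector_space_axioms t(1)])
    show "range (\<lambda>j. ruppert (F t) (g j)) \<subseteq> ruppert (F t) ` sl1"
      using g(1) by blast
    show "ruppert (F t) ` sl1 \<subseteq> mpoly.span ((\<lambda>m. single m 1) ` {m. mdeg m = 4})"
      using ruppert_in_forms[OF F(2)] forms_finite_span by blast
  qed (simp add: finite_monomials)
  moreover have "ruppert_rank (F t) + CARD('k) \<le> 70"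
    using t(2) K(2,3) by (intro ruppert_rank_nullity_le) auto
  ultimately show ?thesis
    by linarith
qed

section \<open>Vector fields annihilating a cubic form\<close>

subsection \<open>Koszul fields\<close>

definition koszul :: "form \<Rightarrow> 5 \<Rightarrow> 5 \<Rightarrow> form ^ 5" where
  "koszul f i j = axis i (pdiff j f) - axis j (pdiff i f)"

lemma koszul_in_sl1:
  assumes "f \<in> forms 3"
  shows "koszul f i j \<in> sl1"
  unfolding sl1_iff
proof
  have "pdiff k f \<in> forms 2" for k
    using assms by (intro forms_pdiff) (simp add: numeral_3_eq_3 numeral_2_eq_2)
  then show "\<forall>k. koszul f i j $ k \<in> forms 2"
    by (auto simp: koszul_def axis_def intro!: forms_diff forms_uminus)
  show "divergence (koszul f i j) = 0"
    by (simp add: koszul_def divergence.diff divergence_axis pdiff_commute)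
qed

lemma ruppert_koszul: "ruppert f (koszul f i j) = 0"
  by (simp add: koszul_def ruppert.diff ruppert_axis mult.commute)

lemma curve_koszul: "curve smul F \<Longrightarrow> curve vmul (\<lambda>t. koszul (F t) i j)"
  unfolding koszul_def
  by (intro curve_diff[OF vfield.vector_space_axioms] curve_axis curve_pdiff)

subsection \<open>The additional field for slice rank at most two\<close>

text \<open>The determinant of \<open>e\<^sub>i, e\<^sub>l, e\<^sub>m, a, b\<close>, that is, the coefficients of the three-vector dual
  to \<open>a \<and> b\<close>.\<close>

definition volume :: "complex ^ 5 \<Rightarrow> complex ^ 5 \<Rightarrow> 5 \<Rightarrow> 5 \<Rightarrow> 5 \<Rightarrow> complex" where
  "volume a b i l m = det (\<chi> r. if r = 0 then axis i 1 else if r = 1 then axis l 1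
     else if r = 2 then axis m 1 else if r = 3 then a else b)"

lemma exhaust_5: "x = 0 \<or> x = 1 \<or> x = 2 \<or> x = 3 \<or> x = 4" for x :: 5
proof (induct x)
  case (of_int z)
  then have "z = 0 \<or> z = 1 \<or> z = 2 \<or> z = 3 \<or> z = 4" by fastforce
  then show ?case by auto
qed

lemma all_5: "(\<forall>x :: 5. P x) \<longleftrightarrow> P 0 \<and> P 1 \<and> P 2 \<and> P 3 \<and> P 4"
  by (metis exhaust_5)

lemma volume_swap_12: "volume a b l i m = - volume a b i l m"
proof -
  let ?A = "(\<chi> r. if r = 0 then axis i 1 else if r = 1 then axis l 1
     else if r = 2 then axis m 1 else if r = 3 then a else b) :: complex^5^5"
  let ?p = "Transposition.transpose 0 1 :: 5 \<Rightarrow> 5"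
  have "det (\<chi> r. ?A $ ?p r) = of_int (sign ?p) * det ?A"
    by (rule det_permute_rows) (simp add: permutes_swap_id)
  moreover have "volume a b l i m = det (\<chi> r. ?A $ ?p r)"
    unfolding volume_def
    by (rule arg_cong[of _ _ det]) (simp add: vec_eq_iff all_5 Transposition.transpose_def)
  ultimately show ?thesis
    by (simp add: volume_def sign_swap_id)
qed

lemma volume_swap_13: "volume a b m l i = - volume a b i l m"
proof -
  let ?A = "(\<chi> r. if r = 0 then axis i 1 else if r = 1 then axis l 1
     else if r = 2 then axis m 1 else if r = 3 then a else b) :: complex^5^5"
  let ?p = "Transposition.transpose 0 2 :: 5 \<Rightarrow> 5"
  have "det (\<chi> r. ?A $ ?p r) = of_int (sign ?p) * det ?A"
    by (rule det_permute_rows) (simp add: permutes_swap_id)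
  moreover have "volume a b m l i = det (\<chi> r. ?A $ ?p r)"
    unfolding volume_def
    by (rule arg_cong[of _ _ det]) (simp add: vec_eq_iff all_5 Transposition.transpose_def)
  ultimately show ?thesis
    by (simp add: volume_def sign_swap_id)
qed

text \<open>Expansion of a determinant along its first row, written without cofactors.\<close>

lemma volume_contract:
  "(\<Sum>i\<in>UNIV. u $ i * volume a b i l m) = det (\<chi> r. if r = 0 then u else if r = 1 then axis l 1
     else if r = 2 then axis m 1 else if r = 3 then a else b)"
proof -
  let ?R = "\<lambda>r :: 5. if r = 1 then axis l 1 else if r = 2 then axis m 1 else if r = 3 then a else b"
  have "(\<Sum>i\<in>UNIV. u $ i * volume a b i l m) =
      (\<Sum>i\<in>UNIV. det (\<chi> r. if r = 0 then u $ i *s axis i 1 else ?R r))"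
    unfolding volume_def by (subst det_row_mul) (rule refl)
  also have "\<dots> = det (\<chi> r. if r = 0 then (\<Sum>i\<in>UNIV. u $ i *s axis i 1) else ?R r)"
    by (subst det_linear_row_sum) (rule finite_class.finite_UNIV refl)+
  finally show ?thesis
    by (simp only: basis_expansion)
qed

lemma volume_contract_eq_0:
  "(\<Sum>i\<in>UNIV. a $ i * volume a b i l m) = 0" "(\<Sum>i\<in>UNIV. b $ i * volume a b i l m) = 0"
  unfolding volume_contract
  by (rule det_identical_rows[of 0 3], simp, simp add: row_def)
    (rule det_identical_rows[of 0 4], simp, simp add: row_def)

lemma sum_rotate:
  "(\<Sum>i\<in>A. \<Sum>j\<in>B. \<Sum>k\<in>C. F i j k) = (\<Sum>k\<in>C. \<Sum>i\<in>A. \<Sum>j\<in>B. F i j k)"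
  by (rule trans[OF sum.cong[OF refl sum.swap] sum.swap])

text \<open>The double sum equals its own negative.\<close>

lemma sum_antisymmetric:
  fixes S :: "'i::finite \<Rightarrow> 'i \<Rightarrow> 'v mpoly"
  assumes "\<And>i l. T l i = - T i l" and "\<And>i l. S l i = S i l"
  shows "(\<Sum>i\<in>UNIV. \<Sum>l\<in>UNIV. smul (T i l) (S i l)) = 0"
proof -
  define X where "X = (\<Sum>i\<in>UNIV. \<Sum>l\<in>UNIV. smul (T i l) (S i l))"
  have "X = (\<Sum>i\<in>UNIV. \<Sum>l\<in>UNIV. smul (T l i) (S l i))"
    unfolding X_def by (rule sum.swap)
  also have "\<dots> = (\<Sum>i\<in>UNIV. \<Sum>l\<in>UNIV. - smul (T i l) (S i l))"
  proof (intro sum.cong refl)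
    fix i l
    show "smul (T l i) (S l i) = - smul (T i l) (S i l)"
      unfolding assms(1)[of l i] assms(2)[of l i] by (rule mpoly.scale_minus_left)
  qed
  also have "\<dots> = - X"
    by (simp only: X_def sum_negf)
  finally have "lookup X m = lookup (- X) m" for m
    by (rule arg_cong)
  then have "X = 0"
    by (intro poly_mapping_eqI) simp
  then show ?thesis
    unfolding X_def .
qed

definition linear_coeffs :: "form \<Rightarrow> complex ^ 5" where
  "linear_coeffs l = (\<chi> i. lookup l (single i 1))"

lemma pdiff_linear_mult:
  assumes "l \<in> forms 1"
  shows "pdiff i l * q = smul (linear_coeffs l $ i) q"
proof -
  have "pdiff i l = single 0 (linear_coeffs l $ i)"
  proof (rule poly_mapping_eqI)
    fix m
    have "m = 0" if "mdeg (m + single i 1) = 1"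
    proof -
      have "mdeg m = 0"
        using that by simp
      then show ?thesis
        unfolding mdeg_eq_sum_UNIV by (intro poly_mapping_eqI) simp
    qed
    then show "lookup (pdiff i l) m = lookup (single 0 (linear_coeffs l $ i)) m"
      using assms
      by (cases "m = 0") (auto simp: lookup_pdiff linear_coeffs_def lookup_single forms_iff_lookup)
  qed
  then show ?thesis by (simp add: smul_def)
qed

text \<open>The vector field dual to the four-form \<open>dl \<and> dl' \<and> dh \<and> dh'\<close>.\<close>

definition slice_field :: "form \<Rightarrow> form \<Rightarrow> form \<Rightarrow> form \<Rightarrow> form ^ 5" where
  "slice_field l l' h h' = (\<chi> i. \<Sum>j\<in>UNIV. \<Sum>k\<in>UNIV.
     smul (volume (linear_coeffs l) (linear_coeffs l') i j k) (pdiff j h * pdiff k h'))"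

lemma sum_slice_field:
  "(\<Sum>i\<in>UNIV. slice_field l l' h h' $ i * q i) = (\<Sum>k\<in>UNIV. \<Sum>i\<in>UNIV. \<Sum>j\<in>UNIV.
     smul (volume (linear_coeffs l) (linear_coeffs l') i j k) (pdiff j h * pdiff k h' * q i))"
proof -
  have "(\<Sum>i\<in>UNIV. slice_field l l' h h' $ i * q i) = (\<Sum>i\<in>UNIV. \<Sum>j\<in>UNIV. \<Sum>k\<in>UNIV.
     smul (volume (linear_coeffs l) (linear_coeffs l') i j k) (pdiff j h * pdiff k h' * q i))"
    by (simp add: slice_field_def sum_distrib_right smul_mult_left)
  then show ?thesis
    by (rule trans[OF _ sum_rotate])
qed

text \<open>The derivative of \<open>u\<close> along the field is a combination of determinants with first row \<open>du\<close>, in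
  which a row now occurs twice.\<close>

lemma slice_field_kills_linear_forms:
  assumes "u \<in> {l, l'}" and "u \<in> forms 1"
  shows "ruppert u (slice_field l l' h h') = 0"
proof -
  let ?v = "volume (linear_coeffs l) (linear_coeffs l')"
  have "ruppert u (slice_field l l' h h') = (\<Sum>k\<in>UNIV. \<Sum>i\<in>UNIV. \<Sum>j\<in>UNIV.
     smul (?v i j k) (pdiff j h * pdiff k h' * pdiff i u))"
    unfolding ruppert_def by (rule sum_slice_field)
  also have "\<dots> = (\<Sum>k\<in>UNIV. \<Sum>i\<in>UNIV. \<Sum>j\<in>UNIV.
     smul (linear_coeffs u $ i * ?v i j k) (pdiff j h * pdiff k h'))"
  proof (intro sum.cong refl)
    fix k j i
    have "pdiff j h * pdiff k h' * pdiff i u = smul (linear_coeffs u $ i) (pdiff j h * pdiff k h')"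
      using pdiff_linear_mult[OF assms(2)] by (metis mult.commute)
    then show "smul (?v i j k) (pdiff j h * pdiff k h' * pdiff i u) =
        smul (linear_coeffs u $ i * ?v i j k) (pdiff j h * pdiff k h')"
      by (simp add: mult.commute)
  qed
  also have "\<dots> = (\<Sum>k\<in>UNIV. \<Sum>j\<in>UNIV. \<Sum>i\<in>UNIV.
     smul (linear_coeffs u $ i * ?v i j k) (pdiff j h * pdiff k h'))"
    by (rule sum.cong[OF refl sum.swap])
  also have "\<dots> = (\<Sum>k\<in>UNIV. \<Sum>j\<in>UNIV.
     smul (\<Sum>i\<in>UNIV. linear_coeffs u $ i * ?v i j k) (pdiff j h * pdiff k h'))"
    by (simp only: mpoly.scale_sum_left)
  also have "\<dots> = 0"
    using assms(1) volume_contract_eq_0 by auto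
  finally show ?thesis .
qed

text \<open>Here the repeated differential is not constant, so the vanishing is read off from the antisymmetry
  of the volume coefficients.\<close>

lemma slice_field_kills_quadrics:
  "ruppert h (slice_field l l' h h') = 0" "ruppert h' (slice_field l l' h h') = 0"
proof -
  let ?v = "volume (linear_coeffs l) (linear_coeffs l')"
  have "(\<Sum>i\<in>UNIV. \<Sum>j\<in>UNIV. smul (?v i j k) (pdiff j h * pdiff k h' * pdiff i h)) = 0" for k
    by (rule sum_antisymmetric) (simp_all add: volume_swap_12[symmetric] mult_ac)
  then show "ruppert h (slice_field l l' h h') = 0"
    unfolding ruppert_def sum_slice_field by simp
  have "(\<Sum>i\<in>UNIV. \<Sum>k\<in>UNIV. smul (?v i j k) (pdiff j h * pdiff k h' * pdiff i h')) = 0" for j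
    by (rule sum_antisymmetric) (simp_all add: volume_swap_13[symmetric] mult_ac)
  moreover have "(\<Sum>k\<in>UNIV. \<Sum>i\<in>UNIV. \<Sum>j\<in>UNIV. smul (?v i j k) (pdiff j h * pdiff k h' * pdiff i h')) =
     (\<Sum>j\<in>UNIV. \<Sum>i\<in>UNIV. \<Sum>k\<in>UNIV. smul (?v i j k) (pdiff j h * pdiff k h' * pdiff i h'))"
    by (subst sum.swap, subst (2) sum.swap, subst sum.swap) (rule refl)
  ultimately show "ruppert h' (slice_field l l' h h') = 0"
    unfolding ruppert_def sum_slice_field by simp
qed

lemma ruppert_add_form: "ruppert (u + v) g = ruppert u g + ruppert v g"
  by (simp add: ruppert_def pdiff_add distrib_left sum.distrib)

lemma ruppert_mult_form: "ruppert (u * v) g = u * ruppert v g + v * ruppert u g"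
  by (simp add: ruppert_def pdiff_mult distrib_left sum.distrib sum_distrib_left mult_ac)

lemma ruppert_slice_field:
  assumes "l \<in> forms 1" and "l' \<in> forms 1"
  shows "ruppert (l * h + l' * h') (slice_field l l' h h') = 0"
  using assms
  by (simp add: ruppert_add_form ruppert_mult_form slice_field_kills_linear_forms
      slice_field_kills_quadrics)

text \<open>Differentiating a coefficient produces second derivatives of \<open>h\<close> or of \<open>h'\<close>, which are symmetric
  in two indices in which the volume coefficients are antisymmetric.\<close>

lemma slice_field_in_sl1:
  assumes "h \<in> forms 2" and "h' \<in> forms 2"
  shows "slice_field l l' h h' \<in> sl1"
  unfolding sl1_iff
proof
  let ?v = "volume (linear_coeffs l) (linear_coeffs l')"
  have "pdiff j h * pdiff k h' \<in> forms (1 + 1)" for j k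
    using assms by (intro forms_mult forms_pdiff) (auto simp: numeral_2_eq_2)
  then show "\<forall>i. slice_field l l' h h' $ i \<in> forms 2"
    unfolding slice_field_def one_add_one by (auto intro!: forms_sum forms_smul)
  have "divergence (slice_field l l' h h') =
      (\<Sum>i\<in>UNIV. \<Sum>j\<in>UNIV. \<Sum>k\<in>UNIV. smul (?v i j k) (pdiff i (pdiff j h) * pdiff k h')) +
      (\<Sum>i\<in>UNIV. \<Sum>j\<in>UNIV. \<Sum>k\<in>UNIV. smul (?v i j k) (pdiff j h * pdiff i (pdiff k h')))"
    by (simp add: divergence_def slice_field_def pdiff_sum pdiff_smul pdiff_mult
        mpoly.scale_right_distrib sum.distrib)
  also have "(\<Sum>i\<in>UNIV. \<Sum>j\<in>UNIV. \<Sum>k\<in>UNIV. smul (?v i j k) (pdiff i (pdiff j h) * pdiff k h')) =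
      (\<Sum>k\<in>UNIV. \<Sum>i\<in>UNIV. \<Sum>j\<in>UNIV. smul (?v i j k) (pdiff i (pdiff j h) * pdiff k h'))"
    by (rule sum_rotate)
  also have "\<dots> = 0"
    by (intro sum.neutral ballI sum_antisymmetric)
      (simp_all add: volume_swap_12[symmetric] pdiff_commute)
  also have "(\<Sum>i\<in>UNIV. \<Sum>j\<in>UNIV. \<Sum>k\<in>UNIV. smul (?v i j k) (pdiff j h * pdiff i (pdiff k h'))) =
      (\<Sum>j\<in>UNIV. \<Sum>i\<in>UNIV. \<Sum>k\<in>UNIV. smul (?v i j k) (pdiff j h * pdiff i (pdiff k h')))"
    by (rule sum.swap)
  also have "\<dots> = 0"
    by (intro sum.neutral ballI sum_antisymmetric)
      (simp_all add: volume_swap_13[symmetric] pdiff_commute)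
  finally show "divergence (slice_field l l' h h') = 0"
    by simp
qed

lemma curve_slice_field:
  assumes "curve smul l" and "curve smul l'" and "curve smul h" and "curve smul h'"
  shows "curve vmul (\<lambda>t. slice_field (l t) (l' t) (h t) (h' t))"
proof (rule curve_vec)
  fix i
  have "curve (*) (\<lambda>t. volume (linear_coeffs (l t)) (linear_coeffs (l' t)) i j k)" for j k
    unfolding volume_def
  proof (rule curve_det)
    fix r s :: 5
    show "curve (*) (\<lambda>t. (\<chi> r. if r = 0 then axis i 1 else if r = 1 then axis j 1
        else if r = 2 then axis k 1 else if r = 3 then linear_coeffs (l t)
        else linear_coeffs (l' t)) $ r $ s)"
      by (cases "r \<in> {0, 1, 2}"; cases "r = 3")
        (auto simp: linear_coeffs_def intro!: curve.const curve_lookup assms)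
  qed
  then show "curve smul (\<lambda>t. slice_field (l t) (l' t) (h t) (h' t) $ i)"
    unfolding slice_field_def vec_lambda_beta
    by (intro curve_sum curve_smul curve_mult curve_pdiff assms)
qed

section \<open>Upper bounds for the rank\<close>

lemma monomial_eq_5:
  "m = n \<longleftrightarrow> lookup m 0 = lookup n 0 \<and> lookup m 1 = lookup n 1 \<and> lookup m 2 = lookup n 2 \<and>
    lookup m 3 = lookup n 3 \<and> lookup m 4 = lookup n 4" for m n :: "5 \<Rightarrow>\<^sub>0 nat"
  by (simp add: poly_mapping_eq_iff fun_eq_iff all_5)

abbreviation var :: "5 \<Rightarrow> form" where
  "var i \<equiv> single (single i 1) 1"

abbreviation quad :: "5 \<Rightarrow> 5 \<Rightarrow> form" where
  "quad i j \<equiv> single (single i 1 + single j 1) 1"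

text \<open>A cubic of the form \<open>l h + l' h'\<close> whose five partial derivatives
  \<open>x\<^sub>2 x\<^sub>3\<close>, \<open>x\<^sub>2 x\<^sub>4\<close>, \<open>x\<^sub>0 x\<^sub>3 + x\<^sub>1 x\<^sub>4\<close>, \<open>x\<^sub>0 x\<^sub>2\<close>, \<open>x\<^sub>1 x\<^sub>2\<close> are pairwise without common monomials.
  Its additional field is, up to sign,
  \<open>x\<^sub>2\<^sup>2 \<partial>\<^sub>2 - x\<^sub>2 x\<^sub>3 \<partial>\<^sub>3 - x\<^sub>2 x\<^sub>4 \<partial>\<^sub>4\<close>.\<close>

definition model_cubic :: form where
  "model_cubic = var 0 * quad 2 3 + var 1 * quad 2 4"

lemma model_cubic_in_forms: "model_cubic \<in> forms 3"
  by (simp add: model_cubic_def mult_single forms_add forms_single)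

text \<open>A monomial that occurs in the \<open>i\<close>-th derivative of the model cubic and in no other. Its coefficients
  separate the Koszul fields.\<close>

definition marker :: "5 \<Rightarrow> 5 \<Rightarrow>\<^sub>0 nat" where
  "marker i = (if i = 0 then single 2 1 + single 3 1 else if i = 1 then single 2 1 + single 4 1
     else if i = 2 then single 0 1 + single 3 1 else if i = 3 then single 0 1 + single 2 1
     else single 1 1 + single 2 1)"

lemma lookup_pdiff_model_cubic_marker:
  "lookup (pdiff j model_cubic) (marker i) = (if i = j then 1 else 0)"
proof -
  have "\<forall>i j. lookup (pdiff j model_cubic) (marker i) = (if i = j then 1 else 0)"
    unfolding all_5 lookup_pdiff model_cubic_def marker_def
    by (simp add: mult_single lookup_add lookup_single when_def monomial_eq_5)
  then show ?thesis by blast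
qed

lemma lookup_pdiff_model_cubic_square: "lookup (pdiff j model_cubic) (single 2 2) = 0"
proof -
  have "\<forall>j. lookup (pdiff j model_cubic) (single 2 2) = 0"
    unfolding all_5 lookup_pdiff model_cubic_def
    by (simp add: mult_single lookup_add lookup_single when_def monomial_eq_5)
  then show ?thesis by blast
qed

lemma linear_coeffs_var: "linear_coeffs (var i) = axis i 1"
proof -
  have "single i (1::nat) = single j 1 \<longleftrightarrow> i = j" for j
    by (metis keys_single singleton_inject zero_neq_one)
  then show ?thesis
    by (simp add: linear_coeffs_def vec_eq_iff axis_def lookup_single when_def)
qed

lemma volume_model: "volume (axis 0 1) (axis 1 1) 2 3 4 \<noteq> 0"
proof -
  (* Indices are residues modulo 5, so the rows 2, 3, 4, 0, 1 are a rotation of the identity. *)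
  let ?p = "\<lambda>r :: 5. r + 2"
  have p: "?p permutes UNIV"
    by (rule bij_imp_permutes) (auto intro!: bij_betw_byWitness[where f' = "\<lambda>r. r - 2"])
  have "volume (axis 0 1) (axis 1 1) 2 3 4 = det (\<chi> r. (mat 1 :: complex^5^5) $ ?p r)"
    unfolding volume_def
    by (rule arg_cong[of _ _ det]) (simp add: vec_eq_iff all_5 axis_def mat_def)
  also have "\<dots> = of_int (sign ?p)"
    by (subst det_permute_rows[OF p]) simp
  finally show ?thesis
    by (simp add: sign_def)
qed

lemma lookup_slice_field_model:
  "lookup (slice_field (var 0) (var 1) (quad 2 3) (quad 2 4) $ 2) (single 2 2) \<noteq> 0"
proof -
  let ?v = "volume (axis 0 1) (axis 1 1)"
  have "\<forall>j k. lookup (pdiff j (quad 2 3) * pdiff k (quad 2 4)) (single 2 2) =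
      (if j = 3 \<and> k = 4 then 1 else 0)"
    unfolding all_5
    by (simp add: pdiff_single mult_single lookup_add lookup_minus lookup_single when_def
        monomial_eq_5)
  then have "lookup (slice_field (var 0) (var 1) (quad 2 3) (quad 2 4) $ 2) (single 2 2) =
      (\<Sum>j :: 5\<in>UNIV. \<Sum>k :: 5\<in>UNIV. if j = 3 then if k = 4 then ?v 2 3 4 else 0 else 0)"
    unfolding slice_field_def linear_coeffs_var vec_lambda_beta lookup_sum lookup_smul
    by (intro sum.cong refl) simp
  also have "\<dots> = (\<Sum>j :: 5\<in>UNIV. if j = 3 then ?v 2 3 4 else 0)"
    by (intro sum.cong refl) simp
  also have "\<dots> = ?v 2 3 4"
    by simp
  finally show ?thesis
    using volume_model by simp
qed

text \<open>The Koszul fields are indexed by the ten unordered pairs of variables, each with an arbitrary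
  orientation.\<close>

lemma pair_enumeration:
  obtains a b :: "10 \<Rightarrow> 5" where "\<And>x. a x \<noteq> b x" and "inj (\<lambda>x. {a x, b x})"
proof -
  let ?P = "{B :: 5 set. B \<subseteq> UNIV \<and> card B = 2}"
  have "card ?P = 10"
    by (subst n_subsets) (simp_all add: choose_two)
  then obtain e :: "10 \<Rightarrow> 5 set" where e: "bij_betw e UNIV ?P"
    using finite_same_card_bij[of "UNIV :: 10 set" ?P] by auto
  then have "e x \<in> ?P" for x
    by (auto simp: bij_betw_def)
  then have "\<forall>x. \<exists>a b. a \<noteq> b \<and> e x = {a, b}"
    by (metis (mono_tags, lifting) card_2_iff mem_Collect_eq)
  then obtain a b where ab: "\<And>x. a x \<noteq> b x" "\<And>x. e x = {a x, b x}"
    by metis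
  have "inj (\<lambda>x. {a x, b x})"
    using e unfolding ab(2)[symmetric] bij_betw_def by simp
  then show ?thesis
    using that ab(1) by blast
qed

lemma lookup_koszul:
  "lookup (koszul f a b $ k) m =
    (if k = a then lookup (pdiff b f) m else 0) - (if k = b then lookup (pdiff a f) m else 0)"
  by (simp add: koszul_def axis_def lookup_minus)

text \<open>The index \<open>None\<close> stands for the additional field. It is the only one of the eleven fields in which
  the coefficient of \<open>x\<^sub>2\<^sup>2 \<partial>\<^sub>2\<close> is nonzero, which removes it from a relation; the marker monomials
  then isolate each Koszul field.\<close>

lemma indep_family_model:
  assumes ne: "\<And>x :: 10. a x \<noteq> b x" and inj: "inj (\<lambda>x. {a x, b x})"
  shows "indep_family vmul (\<lambda>x. case x of
      None \<Rightarrow> slice_field (var 0) (var 1) (quad 2 3) (quad 2 4)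
    | Some p \<Rightarrow> koszul model_cubic (a p) (b p))"
    (is "indep_family vmul (\<lambda>x. case x of None \<Rightarrow> ?\<theta> | Some p \<Rightarrow> ?\<kappa> p)")
  unfolding indep_family_def
proof (intro allI impI)
  fix c :: "10 option \<Rightarrow> complex" and x
  assume "(\<Sum>x\<in>UNIV. vmul (c x) (case x of None \<Rightarrow> ?\<theta> | Some p \<Rightarrow> ?\<kappa> p)) = 0"
  then have s: "vmul (c None) ?\<theta> + (\<Sum>p\<in>UNIV. vmul (c (Some p)) (?\<kappa> p)) = 0"
    by (simp add: UNIV_option_conv sum.reindex)
  have coords: "c None * lookup (?\<theta> $ k) m + (\<Sum>p\<in>UNIV. c (Some p) * lookup (?\<kappa> p $ k) m) = 0" for k m
  proof -
    have "lookup ((vmul (c None) ?\<theta> + (\<Sum>p\<in>UNIV. vmul (c (Some p)) (?\<kappa> p))) $ k) m = 0"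
      unfolding s by simp
    then show ?thesis
      by (simp add: lookup_add lookup_sum)
  qed
  have "lookup (?\<kappa> p $ 2) (single 2 2) = 0" for p
    by (simp add: lookup_koszul lookup_pdiff_model_cubic_square)
  then have None: "c None = 0"
    using coords[of 2 "single 2 2"] lookup_slice_field_model by simp
  have "c (Some q) = 0" for q
  proof -
    have *: "lookup (?\<kappa> p $ a q) (marker (b q)) = (if p = q then 1 else 0)" for p
    proof -
      have eq: "p = q" if "{a p, b p} = {a q, b q}"
        using that inj by (simp add: inj_def)
      have "p = q" if "a p = a q" "b p = b q"
        using that by (intro eq) simp
      moreover have "p = q" if "a p = b q" "b p = a q"
        using that by (intro eq) auto
      ultimately show ?thesis
        using ne[of q] by (auto simp: lookup_koszul lookup_pdiff_model_cubic_marker)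
    qed
    have "(\<Sum>p\<in>UNIV. c (Some p) * lookup (?\<kappa> p $ a q) (marker (b q))) = c (Some q)"
      unfolding * by (simp add: if_distrib cong: if_cong)
    then show ?thesis
      using coords[of "a q" "marker (b q)"] None by simp
  qed
  then show "c x = 0"
    using None by (cases x) auto
qed

text \<open>Along the segment from \<open>f\<close> to the model cubic, the ten Koszul fields are independent at the far
  end. A rank of \<open>61\<close> at \<open>f\<close> would need a source of dimension \<open>71\<close>.\<close>

proposition ruppert_rank_le_60:
  assumes f: "f \<in> forms 3"
  shows "ruppert_rank f \<le> 60"
proof (rule ccontr)
  assume "\<not> ruppert_rank f \<le> 60"
  then have rank: "CARD(61) \<le> ruppert_rank f"
    by simp
  obtain a b :: "10 \<Rightarrow> 5" where ab: "\<And>x. a x \<noteq> b x" "inj (\<lambda>x. {a x, b x})"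
    by (rule pair_enumeration) blast
  define F where "F = (\<lambda>t. f + smul t (model_cubic - f))"
  have F: "curve smul F" "F t \<in> forms 3" for t
    unfolding F_def
    by (rule curve_segment)
      (rule forms_segment[OF f model_cubic_in_forms])
  have "indep_family vmul (\<lambda>x. koszul model_cubic (a x) (b x))"
    using indep_family_comp[OF vfield.vector_space_axioms indep_family_model[OF ab], of Some]
    by (simp add: inj_def)
  then have ind: "indep_family vmul (\<lambda>x. koszul (F 1) (a x) (b x))"
    by (simp add: F_def)
  have "CARD(61) + CARD(10) \<le> 70"
  proof (rule ruppert_rank_bound_along_curve[OF F curve_koszul[OF F(1)]])
    show "koszul (F t) (a x) (b x) \<in> sl1" "ruppert (F t) (koszul (F t) (a x) (b x)) = 0" for x t
      by (rule koszul_in_sl1[OF F(2)]) (rule ruppert_koszul)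
    show "CARD(61) \<le> ruppert_rank (F 0)"
      using rank by (simp add: F_def)
  qed (rule ind)
  then show False by simp
qed

text \<open>The four factors move separately to those of the model cubic, which keeps the form \<open>l h + l' h'\<close> and
  thus the additional field along the whole curve.\<close>

proposition ruppert_rank_le_59:
  assumes l: "l \<in> forms 1" "l' \<in> forms 1" and h: "h \<in> forms 2" "h' \<in> forms 2"
  shows "ruppert_rank (l * h + l' * h') \<le> 59"
proof (rule ccontr)
  assume "\<not> ruppert_rank (l * h + l' * h') \<le> 59"
  then have rank: "CARD(60) \<le> ruppert_rank (l * h + l' * h')"
    by simp
  obtain a b :: "10 \<Rightarrow> 5" where ab: "\<And>x. a x \<noteq> b x" "inj (\<lambda>x. {a x, b x})"
    by (rule pair_enumeration) blast
  define L where "L = (\<lambda>t. l + smul t (var 0 - l))"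
  define L' where "L' = (\<lambda>t. l' + smul t (var 1 - l'))"
  define H where "H = (\<lambda>t. h + smul t (quad 2 3 - h))"
  define H' where "H' = (\<lambda>t. h' + smul t (quad 2 4 - h'))"
  define F where "F = (\<lambda>t. L t * H t + L' t * H' t)"
  define K where "K = (\<lambda>x t. case x of None \<Rightarrow> slice_field (L t) (L' t) (H t) (H' t)
    | Some p \<Rightarrow> koszul (F t) (a p) (b p))"
  have curves: "curve smul L" "curve smul L'" "curve smul H" "curve smul H'"
    unfolding L_def L'_def H_def H'_def
    by (rule curve_segment)+
  have L: "L t \<in> forms 1" "L' t \<in> forms 1" and H: "H t \<in> forms 2" "H' t \<in> forms 2" for t
    unfolding L_def L'_def H_def H'_def
    by (intro forms_segment l h forms_single; simp)+
  have "L t * H t \<in> forms 3" "L' t * H' t \<in> forms 3" for t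
    using forms_mult[OF L(1) H(1)] forms_mult[OF L(2) H(2)] by (simp_all add: numeral_3_eq_3)
  then have F: "curve smul F" "F t \<in> forms 3" for t
    unfolding F_def
    by (auto intro!: curve.add curve_mult curves forms_add)
  have "K x 1 = (case x of None \<Rightarrow> slice_field (var 0) (var 1) (quad 2 3) (quad 2 4)
      | Some p \<Rightarrow> koszul model_cubic (a p) (b p))" for x
    by (simp add: K_def F_def L_def L'_def H_def H'_def model_cubic_def split: option.split)
  then have ind: "indep_family vmul (\<lambda>x. K x 1)"
    using indep_family_model[OF ab] by simp
  have "CARD(60) + CARD(10 option) \<le> 70"
  proof (rule ruppert_rank_bound_along_curve[OF F])
    show "curve vmul (K x)" for x
      unfolding K_def using F(1) curves
      by (cases x) (simp_all add: curve_slice_field curve_koszul)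
    show "K x t \<in> sl1" for x t
      using F(2) H by (auto simp: K_def koszul_in_sl1 slice_field_in_sl1 split: option.split)
    show "ruppert (F t) (K x t) = 0" for x t
      using L by (auto simp: K_def F_def ruppert_koszul ruppert_slice_field split: option.split)
    show "CARD(60) \<le> ruppert_rank (F 0)"
      using rank by (simp add: F_def L_def L'_def H_def H'_def)
  qed (rule ind)
  then show False by simp
qed

section \<open>The rank at the Fermat cubic\<close>

definition fermat_cubic :: form where
  "fermat_cubic = (\<Sum>i\<in>UNIV. single (single i 3) 1)"

lemma fermat_cubic_in_forms: "fermat_cubic \<in> forms 3"
  by (simp add: fermat_cubic_def forms_sum forms_single)

lemma pdiff_fermat_cubic: "pdiff k fermat_cubic = single (single k 2) 3"
proof -
  have "single k 3 - single k 1 = single k (2::nat)"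
    by (simp add: single_diff[symmetric])
  then have "pdiff k fermat_cubic = (\<Sum>i\<in>UNIV. if i = k then single (single k 2) 3 else 0)"
    unfolding fermat_cubic_def pdiff_sum pdiff_single
    by (intro sum.cong) (auto simp: lookup_single when_def)
  then show ?thesis by simp
qed

text \<open>The quartic monomials with a square factor, except the fourth powers. The latter are excluded
  because the passage to the divergence-free part alters an image by fourth powers.\<close>

definition square_monomials :: "(5 \<Rightarrow>\<^sub>0 nat) set" where
  "square_monomials = {m. mdeg m = 4 \<and> (\<exists>i. lookup m i \<in> {2, 3})}"

lemma finite_square_monomials: "finite square_monomials"
  by (rule finite_subset[OF _ finite_monomials[of 4]]) (auto simp: square_monomials_def)

text \<open>Of the \<open>70\<close> quartic monomials, the missing ones are the five fourth powers and the five products of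
  four distinct variables.\<close>

lemma card_square_monomials: "60 \<le> card square_monomials"
proof -
  let ?A = "range (\<lambda>i :: 5. single i (4::nat))"
  let ?B = "range (\<lambda>i :: 5. \<Sum>v\<in>- {i}. single v (1::nat))"
  have "{m. mdeg m = 4} \<subseteq> square_monomials \<union> (?A \<union> ?B)"
  proof
    fix m :: "5 \<Rightarrow>\<^sub>0 nat" assume "m \<in> {m. mdeg m = 4}"
    then have deg: "(\<Sum>v\<in>UNIV. lookup m v) = 4"
      by (simp add: mdeg_eq_sum_UNIV)
    show "m \<in> square_monomials \<union> (?A \<union> ?B)"
    proof (cases "m \<in> square_monomials")
      case False
      then have not: "lookup m v \<noteq> 2" "lookup m v \<noteq> 3" for v
        using deg by (auto simp: square_monomials_def mdeg_eq_sum_UNIV)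
      show ?thesis
      proof (cases "\<exists>i. lookup m i \<ge> 4")
        case True
        then obtain i where i: "lookup m i \<ge> 4" ..
        have "lookup m i + (\<Sum>v\<in>UNIV - {i}. lookup m v) = 4"
          using deg by (simp add: sum.remove[of UNIV i])
        then have "lookup m i = 4" "(\<Sum>v\<in>UNIV - {i}. lookup m v) = 0"
          using i by linarith+
        then have "m = single i 4"
          by (intro poly_mapping_eqI) (auto simp: lookup_single when_def)
        then show ?thesis by blast
      next
        case False
        have le: "lookup m v \<le> 1" for v
          using not[of v] False by (metis One_nat_def Suc_leI linorder_not_le numeral_2_eq_2
              numeral_3_eq_3 numeral_Bit0 numeral_One add_2_eq_Suc le_antisym not_less_eq_eq)
        (* All exponents are 0 or 1 and add up to 4, so exactly one of the five is missing. *)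
        have "(\<Sum>v\<in>UNIV. lookup m v) + (\<Sum>v\<in>UNIV. 1 - lookup m v) = (\<Sum>v\<in>(UNIV :: 5 set). 1)"
          unfolding sum.distrib[symmetric] using le by (intro sum.cong) auto
        then have "(\<Sum>v\<in>UNIV. 1 - lookup m v) = 1"
          using deg by simp
        then obtain i where i: "1 - lookup m i = 1" "\<forall>v\<in>UNIV. i \<noteq> v \<longrightarrow> 1 - lookup m v = 0"
          using sum_eq_1_iff[of UNIV "\<lambda>v. 1 - lookup m v"] by auto
        have "m = (\<Sum>v\<in>- {i}. single v 1)"
        proof (rule poly_mapping_eqI)
          fix k
          have "lookup (\<Sum>v\<in>- {i}. single v 1) k = (\<Sum>v\<in>- {i}. if v = k then 1 else 0)"
            by (simp add: lookup_sum lookup_single when_def)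
          also have "\<dots> = (if k = i then 0 else 1)"
            by simp
          also have "\<dots> = lookup m k"
          proof (cases "k = i")
            case True
            then show ?thesis using i(1) by simp
          next
            case False
            then have "1 - lookup m k = 0"
              using i(2) by simp
            then show ?thesis using False le[of k] by simp
          qed
          finally show "lookup m k = lookup (\<Sum>v\<in>- {i}. single v 1) k"
            by (rule sym)
        qed
        then show ?thesis by blast
      qed
    qed simp
  qed
  then have "card {m :: 5 \<Rightarrow>\<^sub>0 nat. mdeg m = 4} \<le> card (square_monomials \<union> (?A \<union> ?B))"
    by (intro card_mono) (simp_all add: finite_square_monomials)
  also have "\<dots> \<le> card square_monomials + (card ?A + card ?B)"
    by (rule order_trans[OF card_Un_le add_left_mono[OF card_Un_le]])
  also have "\<dots> \<le> card square_monomials + (5 + 5)"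
    using card_image_le[of "UNIV :: 5 set" "\<lambda>i. single i (4::nat)"]
      card_image_le[of "UNIV :: 5 set" "\<lambda>i. \<Sum>v\<in>- {i}. single v (1::nat)"]
    by simp
  finally show ?thesis
    by (simp add: card_monomials eval_nat_numeral)
qed

text \<open>As \<open>\<partial>\<^sub>i\<close> of the Fermat cubic is \<open>3 x\<^sub>i\<^sup>2\<close>, the field \<open>(m / x\<^sub>i\<^sup>2) \<partial>\<^sub>i\<close> is sent to \<open>3 m\<close>, and the
  correction terms \<open>x\<^sub>j\<^sup>2 \<partial>\<^sub>j\<close> are sent to multiples of \<open>x\<^sub>j\<^sup>4\<close>.\<close>

lemma ruppert_fermat_div_free_part:
  assumes m: "lookup m i \<in> {2, 3}" and n: "n \<in> square_monomials"
  shows "lookup (ruppert fermat_cubic (div_free_part (axis i (single (m - single i 2) 1)))) n =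
    (if m = n then 3 else 0)"
proof -
  have "m - single i 2 + single i 2 = m"
    using m by (intro poly_mapping_eqI) (auto simp: lookup_add lookup_minus lookup_single when_def)
  moreover have "single j 4 \<noteq> n" for j :: 5
    using n by (auto simp: square_monomials_def lookup_single when_def split: if_splits)
  ultimately show ?thesis
    by (simp add: div_free_part_def ruppert.diff ruppert.sum ruppert_axis pdiff_fermat_cubic
        mult_single lookup_minus lookup_sum lookup_single when_def single_add[symmetric])
qed

lemma fermat_indep_family:
  obtains g :: "60 \<Rightarrow> form ^ 5"
  where "range g \<subseteq> sl1" and "indep_family smul (\<lambda>x. ruppert fermat_cubic (g x))"
proof -
  obtain T where T: "T \<subseteq> square_monomials" "card T = 60" "finite T"
    using obtain_subset_with_card_n[OF card_square_monomials] by blast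
  then obtain e :: "60 \<Rightarrow> 5 \<Rightarrow>\<^sub>0 nat" where e: "bij_betw e UNIV T"
    using finite_same_card_bij[of "UNIV :: 60 set" T] by auto
  then have sq: "e x \<in> square_monomials" for x
    using T(1) by (auto simp: bij_betw_def)
  then have "\<forall>x. \<exists>i. lookup (e x) i \<in> {2, 3}"
    by (auto simp: square_monomials_def)
  then obtain i where i: "\<And>x. lookup (e x) (i x) \<in> {2, 3}"
    by metis
  define g where "g = (\<lambda>x. div_free_part (axis (i x) (single (e x - single (i x) 2) 1)))"
  have "g x \<in> sl1" for x
    unfolding g_def
  proof (rule div_free_part_in_sl1)
    have "e x - single (i x) 2 + single (i x) 2 = e x"
      using i[of x] by (intro poly_mapping_eqI)
        (auto simp: lookup_add lookup_minus lookup_single when_def)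
    then have "mdeg (e x - single (i x) 2) + 2 = 4"
      using sq[of x] by (metis (mono_tags, lifting) mdeg_add mdeg_single mem_Collect_eq
          square_monomials_def)
    then show "axis (i x) (single (e x - single (i x) 2) 1) $ k \<in> forms 2" for k
      by (simp add: axis_def forms_single)
  qed
  moreover have "indep_family smul (\<lambda>x. ruppert fermat_cubic (g x))"
    unfolding indep_family_def
  proof (intro allI impI)
    fix c y assume s: "(\<Sum>x\<in>UNIV. smul (c x) (ruppert fermat_cubic (g x))) = 0"
    have *: "lookup (ruppert fermat_cubic (g x)) (e y) = (if x = y then 3 else 0)" for x
      unfolding g_def ruppert_fermat_div_free_part[OF i sq]
      using e by (auto simp: bij_betw_def inj_def)
    have "lookup (\<Sum>x\<in>UNIV. smul (c x) (ruppert fermat_cubic (g x))) (e y) = 3 * c y"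
      unfolding lookup_sum lookup_smul * by (simp add: if_distrib cong: if_cong)
    then show "c y = 0"
      unfolding s by simp
  qed
  ultimately show ?thesis
    using that by blast
qed

section \<open>Minors as polynomials in the coefficients\<close>

lemma coord_ring_add: "P \<in> coord_ring d \<Longrightarrow> Q \<in> coord_ring d \<Longrightarrow> P + Q \<in> coord_ring d"
  using keys_add[of P Q] by (fastforce simp: coord_ring_def)

lemma coord_ring_mult:
  assumes P: "P \<in> coord_ring d" and Q: "Q \<in> coord_ring d"
  shows "P * Q \<in> coord_ring d"
  unfolding coord_ring_def
proof (intro CollectI ballI)
  fix m \<alpha> assume m: "m \<in> Poly_Mapping.keys (P * Q)" and \<alpha>: "\<alpha> \<in> Poly_Mapping.keys m"
  obtain a b where "m = a + b" "a \<in> Poly_Mapping.keys P" "b \<in> Poly_Mapping.keys Q"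
    using m keys_mult[of P Q] by blast
  then show "mdeg \<alpha> = d"
    using \<alpha> keys_add[of a b] P Q by (auto simp: coord_ring_def)
qed

lemma coord_ring_uminus: "P \<in> coord_ring d \<Longrightarrow> - P \<in> coord_ring d"
  by (auto simp: coord_ring_def in_keys_iff)

lemma coord_ring_zero: "0 \<in> coord_ring d"
  by (simp add: coord_ring_def)

lemma coord_ring_one: "1 \<in> coord_ring d"
  by (simp add: coord_ring_def)

lemma coord_ring_sum: "(\<And>i. i \<in> A \<Longrightarrow> P i \<in> coord_ring d) \<Longrightarrow> (\<Sum>i\<in>A. P i) \<in> coord_ring d"
  by (induction A rule: infinite_finite_induct) (auto intro: coord_ring_add coord_ring_zero)

lemma coord_ring_prod: "(\<And>i. i \<in> A \<Longrightarrow> P i \<in> coord_ring d) \<Longrightarrow> (\<Prod>i\<in>A. P i) \<in> coord_ring d"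
  by (induction A rule: infinite_finite_induct) (auto intro: coord_ring_mult coord_ring_one)

lemma coord_ring_det:
  fixes A :: "coeff_poly^'k::finite^'k"
  assumes "\<And>i j. A $ i $ j \<in> coord_ring d"
  shows "det A \<in> coord_ring d"
  unfolding det_def
proof (rule coord_ring_sum)
  fix \<pi> :: "'k \<Rightarrow> 'k"
  show "of_int (sign \<pi>) * (\<Prod>i\<in>UNIV. A $ i $ \<pi> i) \<in> coord_ring d"
    using coord_ring_prod[of UNIV "\<lambda>i. A $ i $ \<pi> i" d] assms
    by (auto simp: sign_def coord_ring_uminus)
qed

definition entry_poly :: "form set \<Rightarrow> form ^ 5 \<Rightarrow> form \<Rightarrow> coeff_poly" where
  "entry_poly C g b = (\<Sum>\<alpha>\<in>{\<alpha>. mdeg \<alpha> = 3}.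
     single (single \<alpha> 1) (mpoly.representation C (ruppert (single \<alpha> 1) g) b))"

definition minor_poly :: "form set \<Rightarrow> ('k::finite \<Rightarrow> form) \<Rightarrow> ('k \<Rightarrow> form ^ 5) \<Rightarrow> coeff_poly" where
  "minor_poly C r s = det (\<chi> i j. entry_poly C (s j) (r i))"

lemma entry_poly_in_forms: "entry_poly C g b \<in> forms 1"
  unfolding entry_poly_def by (intro forms_sum forms_single) simp

lemma entry_poly_in_coord_ring: "entry_poly C g b \<in> coord_ring 3"
  unfolding entry_poly_def by (intro coord_ring_sum) (simp add: coord_ring_def)

lemma minor_poly_in_forms: "minor_poly C (r :: 'k::finite \<Rightarrow> form) s \<in> forms CARD('k)"
  unfolding minor_poly_def by (rule forms_det) (simp add: entry_poly_in_forms del: One_nat_def)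

lemma minor_poly_in_coord_ring: "minor_poly C r s \<in> coord_ring 3"
  unfolding minor_poly_def by (rule coord_ring_det) (simp add: entry_poly_in_coord_ring)

text \<open>The Ruppert map depends linearly on the cubic, so a matrix entry is the combination of its values at
  the monomials with the coefficients of the cubic.\<close>

lemma eval_entry_poly:
  assumes C: "mpoly.independent C" "mpoly.span C = forms 4" and f: "f \<in> forms 3" and g: "g \<in> sl1"
  shows "eval_form (entry_poly C g b) f = mpoly.representation C (ruppert f g) b"
proof -
  interpret R: Vector_Spaces.linear smul smul "\<lambda>f. ruppert f g" by (rule linear_ruppert_form)
  have in_span: "ruppert (single \<alpha> 1) g \<in> mpoly.span C" if "mdeg \<alpha> = 3" for \<alpha>
    unfolding C(2) using that g by (intro ruppert_in_forms forms_single)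
  have "ruppert f g = (\<Sum>\<alpha>\<in>{\<alpha>. mdeg \<alpha> = 3}. smul (lookup f \<alpha>) (ruppert (single \<alpha> 1) g))"
    by (subst form_eq_sum_monomials[OF f]) (simp only: R.sum R.scale)
  also have "mpoly.representation C \<dots> b =
      (\<Sum>\<alpha>\<in>{\<alpha>. mdeg \<alpha> = 3}. lookup f \<alpha> * mpoly.representation C (ruppert (single \<alpha> 1) g) b)"
    using in_span
    by (subst mpoly.representation_sum[OF C(1)])
      (auto intro!: mpoly.span_scale sum.cong simp: mpoly.representation_scale[OF C(1)])
  also have "\<dots> = eval_form (entry_poly C g b) f"
    unfolding eval_form_def entry_poly_def eval_mpoly_sum eval_mpoly_single
    by (simp add: eval_monom_def mult.commute)
  finally show ?thesis by (rule sym)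
qed

lemma eval_minor_poly:
  assumes "mpoly.independent C" "mpoly.span C = forms 4" and "f \<in> forms 3" and "range s \<subseteq> sl1"
  shows "eval_form (minor_poly C r s) f = ruppert_minor C r s f"
proof -
  have "eval_mpoly (entry_poly C (s j) (r i)) (lookup f) =
      mpoly.representation C (ruppert f (s j)) (r i)" for i j
    using eval_entry_poly[OF assms(1-3), of "s j" "r i"] assms(4) by (auto simp: eval_form_def)
  then show ?thesis
    by (simp add: eval_form_def minor_poly_def ruppert_minor_def eval_mpoly_det)
qed

lemma card_le_rank_if_minor_nonzero:
  fixes r :: "'k::finite \<Rightarrow> form"
  assumes C: "mpoly.independent C" "mpoly.span C = forms 4" and f: "f \<in> forms 3"
    and s: "range s \<subseteq> sl1" and nz: "ruppert_minor C r s f \<noteq> 0"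
  shows "CARD('k) \<le> ruppert_rank f"
proof -
  have forms: "ruppert f (s j) \<in> mpoly.span C" for j
    unfolding C(2) using f s by (intro ruppert_in_forms) auto
  have "indep_family smul (\<lambda>j. ruppert f (s j))"
  proof (rule det_nonzero_imp_indep_family[OF mpoly.vector_space_axioms,
        where \<phi> = "\<lambda>i v. mpoly.representation C v (r i)"])
    show "mpoly.representation C (\<Sum>j\<in>UNIV. smul (c j) (ruppert f (s j))) (r i) =
        (\<Sum>j\<in>UNIV. c j * mpoly.representation C (ruppert f (s j)) (r i))" for i c
      using forms
      by (subst mpoly.representation_sum[OF C(1)])
        (auto intro!: mpoly.span_scale sum.cong simp: mpoly.representation_scale[OF C(1)])
  qed (use nz in \<open>simp add: ruppert_minor_def\<close>)
  then show ?thesis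
    unfolding ruppert_rank_def
  proof (rule card_le_dim_indep_family[OF mpoly.vector_space_axioms])
    show "range (\<lambda>j. ruppert f (s j)) \<subseteq> ruppert f ` sl1"
      using s by auto
    show "ruppert f ` sl1 \<subseteq> mpoly.span ((\<lambda>m. single m 1) ` {m. mdeg m = 4})"
      using ruppert_in_forms[OF f] forms_finite_span by blast
  qed (simp add: finite_monomials)
qed

text \<open>The columns are chosen first, so that the images of the chosen basis fields are independent, and the
  rows by exchange.\<close>

lemma exists_nonzero_minor:
  assumes B: "vfield.span B = sl1" and C: "mpoly.independent C" "mpoly.span C = forms 4"
    and f: "f \<in> forms 3" and rank: "CARD('k::finite) \<le> ruppert_rank f"
  obtains r :: "'k::finite \<Rightarrow> form" and s where "inj r" and "range r \<subseteq> C" and "inj s" and "range s \<subseteq> B"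
    and "ruppert_minor C r s f \<noteq> 0"
proof -
  have "ruppert f ` sl1 = mpoly.span (ruppert f ` B)"
    unfolding B[symmetric] by (rule ruppert.span_image[symmetric])
  then have "CARD('k) \<le> mpoly.dim (ruppert f ` B)"
    using rank by (simp add: ruppert_rank_def)
  then obtain w :: "'k \<Rightarrow> form" where w: "indep_family smul w" "range w \<subseteq> ruppert f ` B"
    by (rule indep_family_of_dim[OF mpoly.vector_space_axioms])
  then have "\<forall>j. \<exists>g\<in>B. w j = ruppert f g"
    by blast
  then obtain s where s: "\<And>j. s j \<in> B" "\<And>j. w j = ruppert f (s j)"
    by metis
  have "inj w"
    using w(1) indep_family_iff[OF mpoly.vector_space_axioms, of w] by simp
  then have inj: "inj s"
    using s(2) by (auto simp: inj_def)
  have "s j \<in> sl1" for j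
    using vfield.span_base[OF s(1), of j] unfolding B .
  then have "range w \<subseteq> mpoly.span C"
    unfolding C(2) using s(2) ruppert_in_forms[OF f] by auto
  moreover have "finite C"
  proof -
    have "C \<subseteq> mpoly.span ((\<lambda>m. single m 1) ` {m. mdeg m = 4})"
      using mpoly.span_superset[of C] forms_finite_span[of 4] C(2) by auto
    then show ?thesis
      using mpoly.independent_span_bound[OF _ C(1)] finite_monomials[of 4, where 'v = 5] by blast
  qed
  ultimately obtain r :: "'k \<Rightarrow> form" where "inj r" "range r \<subseteq> C"
    "det (\<chi> i j. mpoly.representation C (w j) (r i)) \<noteq> 0"
    using indep_family_imp_minor[OF mpoly.vector_space_axioms w(1) _ C(1)] by metis
  then show ?thesis
    using that[of r s] inj s by (auto simp: ruppert_minor_def)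
qed

section \<open>Slice rank and the secant variety\<close>

text \<open>Factoring a variable out of every monomial shows that the minimum in the definition of the slice rank
  is taken over a nonempty set, so that it is attained.\<close>

lemma form_eq_sum_linear_multiples:
  assumes "f \<in> forms (Suc d)"
  shows "\<exists>r l h. (\<forall>i<r. l i \<in> forms 1 \<and> h i \<in> forms d) \<and> f = (\<Sum>i<(r::nat). l i * h i)"
proof -
  let ?K = "Poly_Mapping.keys f"
  obtain e where e: "bij_betw e {..<card ?K} ?K"
    using ex_bij_betw_nat_finite[of ?K] by (auto simp: atLeast0LessThan)
  have "\<forall>m\<in>?K. \<exists>v. lookup m v \<noteq> 0"
  proof
    fix m assume "m \<in> ?K"
    then have "mdeg m \<noteq> 0"
      using assms by (simp add: forms_def)
    then show "\<exists>v. lookup m v \<noteq> 0"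
      unfolding mdeg_def by (metis sum.neutral)
  qed
  then obtain v where v: "\<And>m. m \<in> ?K \<Longrightarrow> lookup m (v m) \<noteq> 0"
    by metis
  define l :: "('a \<Rightarrow>\<^sub>0 nat) \<Rightarrow> 'a mpoly" where "l = (\<lambda>m. single (single (v m) 1) 1)"
  define h where "h = (\<lambda>m. single (m - single (v m) 1) (lookup f m))"
  have split: "single (v m) 1 + (m - single (v m) 1) = m" if "m \<in> ?K" for m
    using v[OF that]
    by (intro poly_mapping_eqI) (auto simp: lookup_add lookup_minus lookup_single when_def)
  have "l m * h m = single m (lookup f m)" if "m \<in> ?K" for m
    using split[OF that] by (simp add: l_def h_def mult_single)
  then have "f = (\<Sum>m\<in>?K. l m * h m)"
    using poly_mapping_sum_single[of f] by simp
  also have "\<dots> = (\<Sum>i<card ?K. l (e i) * h (e i))"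
    by (rule sum.reindex_bij_betw[OF e, symmetric])
  finally have "f = (\<Sum>i<card ?K. l (e i) * h (e i))" .
  moreover have "l m \<in> forms 1 \<and> h m \<in> forms d" if "m \<in> ?K" for m
  proof -
    have "mdeg (single (v m) 1) + mdeg (m - single (v m) 1) = Suc d"
      using split[OF that] assms that unfolding mdeg_add[symmetric] by (simp add: forms_def)
    then show ?thesis
      by (simp add: l_def h_def forms_single)
  qed
  then have "\<forall>i<card ?K. l (e i) \<in> forms 1 \<and> h (e i) \<in> forms d"
    using e by (auto simp: bij_betw_def)
  ultimately show ?thesis
    by (intro exI[of _ "card ?K"] exI[of _ "\<lambda>i. l (e i)"] exI[of _ "\<lambda>i. h (e i)"] conjI)
qed

lemma slice_rank_le_2_imp:
  assumes f: "f \<in> forms 3" and rank: "slice_rank 3 f \<le> 2"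
  obtains l l' h h' where "l \<in> forms 1" "l' \<in> forms 1" "h \<in> forms 2" "h' \<in> forms 2"
    and "f = l * h + l' * h'"
proof -
  let ?P = "\<lambda>r::nat. \<exists>l h. (\<forall>i<r. l i \<in> forms 1 \<and> h i \<in> forms (3 - 1)) \<and> f = (\<Sum>i<r. l i * h i)"
  have "\<exists>r. ?P r"
    using form_eq_sum_linear_multiples[of f 2] f by simp
  then have "?P (slice_rank 3 f)"
    unfolding slice_rank_def by (rule LeastI_ex)
  then obtain l h where lh: "\<And>i. i < slice_rank 3 f \<Longrightarrow> l i \<in> forms 1 \<and> h i \<in> forms 2"
    and sum: "f = (\<Sum>i<slice_rank 3 f. l i * h i)"
    by auto
  (* Padding with zero summands gives exactly two products. *)
  define l' where "l' = (\<lambda>i. if i < slice_rank 3 f then l i else 0)"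
  have "f = (\<Sum>i<slice_rank 3 f. l' i * h i)"
    unfolding l'_def by (subst sum) simp
  also have "\<dots> = (\<Sum>i<2. l' i * h i)"
    using rank by (intro sum.mono_neutral_left) (auto simp: l'_def)
  finally have "f = l' 0 * (if 0 < slice_rank 3 f then h 0 else 0) +
      l' 1 * (if 1 < slice_rank 3 f then h 1 else 0)"
    by (auto simp: numeral_2_eq_2 l'_def)
  then show ?thesis
    using lh by (intro that[of "l' 0" "l' 1"]) (auto simp: l'_def)
qed

lemma linear_times_quadric_in_forms: "l \<in> forms 1 \<Longrightarrow> h \<in> forms 2 \<Longrightarrow> l * h \<in> forms 3"
  using forms_mult[of l 1 h 2] by (simp add: numeral_3_eq_3)

lemma proj_line_reducible_cubics:
  assumes "p \<in> reducible_cubics" and "q \<in> reducible_cubics" and "z \<in> proj_line p q"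
  obtains f l l' h h' where "z = mpoly.span {f}" and "f \<noteq> 0" and "f = l * h + l' * h'"
    and "l \<in> forms 1" "l' \<in> forms 1" "h \<in> forms 2" "h' \<in> forms 2"
proof -
  obtain l h where l: "l \<in> forms 1" "h \<in> forms 2" "p = mpoly.span {l * h}"
    using assms(1) unfolding reducible_cubics_def by blast
  obtain l' h' where l': "l' \<in> forms 1" "h' \<in> forms 2" "q = mpoly.span {l' * h'}"
    using assms(2) unfolding reducible_cubics_def by blast
  obtain f where f: "z = mpoly.span {f}" "f \<noteq> 0" "f \<in> mpoly.span (p \<union> q)"
    using assms(3) unfolding proj_line_def by blast
  have "f \<in> {x + y | x y. x \<in> mpoly.span {l * h} \<and> y \<in> mpoly.span {l' * h'}}"
    using f(3) unfolding l(3) l'(3) mpoly.span_Un mpoly.span_span .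
  then obtain a b where "f = smul a (l * h) + smul b (l' * h')"
    unfolding mpoly.span_singleton by blast
  then have "f = smul a l * h + smul b l' * h'"
    by (simp add: smul_mult_left)
  then show ?thesis
    using that[OF f(1,2)] forms_smul l(1,2) l'(1,2) by blast
qed

text \<open>The zero locus of \<open>P\<close> is closed, and by hypothesis it contains the lines whose union has the
  secant variety as closure.\<close>

lemma vanishes_on_secant:
  assumes P: "P \<in> coord_ring 3" "P \<in> forms e"
    and zero: "\<And>l l' h h'. l \<in> forms 1 \<Longrightarrow> l' \<in> forms 1 \<Longrightarrow> h \<in> forms 2 \<Longrightarrow> h' \<in> forms 2 \<Longrightarrow>
      eval_form P (l * h + l' * h') = 0"
  shows "vanishes_on P (secant2 3 reducible_cubics)"
proof -
  let ?Z = "{p \<in> proj_forms 3. \<forall>Q\<in>{P}. vanishes_on Q {p}}"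
  have "proj_closed 3 ?Z"
    unfolding proj_closed_def using P by (intro exI[of _ "{P}"]) blast
  moreover have "\<Union>{proj_line p q | p q. p \<in> reducible_cubics \<and> q \<in> reducible_cubics \<and> p \<noteq> q} \<subseteq> ?Z"
  proof
    fix z assume "z \<in> \<Union>{proj_line p q | p q. p \<in> reducible_cubics \<and> q \<in> reducible_cubics \<and> p \<noteq> q}"
    then obtain p q where "p \<in> reducible_cubics" "q \<in> reducible_cubics" "z \<in> proj_line p q"
      by blast
    then obtain f l l' h h' where z: "z = mpoly.span {f}" "f \<noteq> 0" "f = l * h + l' * h'"
      and forms: "l \<in> forms 1" "l' \<in> forms 1" "h \<in> forms 2" "h' \<in> forms 2"
      by (rule proj_line_reducible_cubics)
    have "l * h \<in> forms 3" "l' * h' \<in> forms 3"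
      using forms by (simp_all add: linear_times_quadric_in_forms del: One_nat_def)
    then have "f \<in> forms 3"
      unfolding z(3) by (rule forms_add)
    then have "z \<in> proj_forms 3"
      using z(1,2) unfolding proj_forms_def by blast
    moreover have "eval_form P g = 0" if g: "g \<in> z" for g
    proof -
      obtain c where "g = smul c f"
        using g unfolding z(1) mpoly.span_singleton by blast
      then have "g = smul c l * h + smul c l' * h'"
        by (simp add: z(3) smul_mult_left mpoly.scale_right_distrib)
      then show ?thesis
        using zero forms forms_smul by blast
    qed
    ultimately show "z \<in> ?Z"
      by (simp add: vanishes_on_def)
  qed
  ultimately have "secant2 3 reducible_cubics \<subseteq> ?Z"
    unfolding secant2_def proj_closure_def by blast
  then show ?thesis
    by (auto simp: vanishes_on_def)
qed

lemma fermat_rank: "60 \<le> ruppert_rank fermat_cubic"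
proof -
  obtain g :: "60 \<Rightarrow> form ^ 5" where g: "range g \<subseteq> sl1"
    "indep_family smul (\<lambda>x. ruppert fermat_cubic (g x))"
    by (rule fermat_indep_family)
  have "CARD(60) \<le> ruppert_rank fermat_cubic"
    unfolding ruppert_rank_def
  proof (rule card_le_dim_indep_family[OF mpoly.vector_space_axioms g(2)])
    show "range (\<lambda>x. ruppert fermat_cubic (g x)) \<subseteq> ruppert fermat_cubic ` sl1"
      using g(1) by auto
    show "ruppert fermat_cubic ` sl1 \<subseteq> mpoly.span ((\<lambda>m. single m 1) ` {m. mdeg m = 4})"
      using ruppert_in_forms[OF fermat_cubic_in_forms] forms_finite_span by blast
  qed (simp add: finite_monomials)
  then show ?thesis by simp
qed

text \<open>The open set is the locus where one minor, chosen to be nonzero at the Fermat cubic, does not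
  vanish.\<close>

lemma generic_rank:
  "\<exists>U. zariski_open 3 U \<and> U \<noteq> {} \<and> (\<forall>f\<in>U. ruppert_rank f = 60)"
proof -
  obtain B where B: "B \<subseteq> sl1" "sl1 \<subseteq> vfield.span B"
    using vfield.basis_exists by metis
  then have B: "vfield.span B = sl1"
    using vfield.span_minimal[OF B(1) subspace_sl1] by blast
  obtain C :: "form set" where C: "C \<subseteq> forms 4" "mpoly.independent C" "forms 4 \<subseteq> mpoly.span C"
    by (rule mpoly.basis_exists)
  then have C4: "mpoly.span C = forms 4"
    using mpoly.span_minimal[OF C(1) subspace_forms] by blast
  have "CARD(60) \<le> ruppert_rank fermat_cubic"
    using fermat_rank by simp
  then obtain r :: "60 \<Rightarrow> form" and s where s: "range s \<subseteq> B"
    and nz: "ruppert_minor C r s fermat_cubic \<noteq> 0"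
    by (rule exists_nonzero_minor[OF B C(2) C4 fermat_cubic_in_forms]) blast
  have sl: "range s \<subseteq> sl1"
    using s vfield.span_superset[of B] B by auto
  note eval = eval_minor_poly[OF C(2) C4 _ sl, where r = r]
  let ?U = "{f \<in> forms 3. \<exists>P\<in>{minor_poly C r s}. eval_form P f \<noteq> 0}"
  have "zariski_open 3 ?U"
    unfolding zariski_open_def
    by (intro exI[of _ "{minor_poly C r s}"]) (simp add: minor_poly_in_coord_ring)
  moreover have "fermat_cubic \<in> ?U"
    using nz eval[OF fermat_cubic_in_forms] fermat_cubic_in_forms by simp
  moreover have "ruppert_rank f = 60" if f: "f \<in> ?U" for f
  proof -
    have "CARD(60) \<le> ruppert_rank f"
      using f eval by (intro card_le_rank_if_minor_nonzero[OF C(2) C4 _ sl, where r = r]) auto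
    then show ?thesis
      using ruppert_rank_le_60[of f] f by simp
  qed
  ultimately show ?thesis
    by (intro exI[of _ ?U]) blast
qed

theorem theorem4p3:
  shows "(\<exists>U. zariski_open 3 U \<and> U \<noteq> {} \<and> (\<forall>f\<in>U. ruppert_rank f = 60)) \<and>
    (\<forall>f\<in>forms 3. slice_rank 3 f \<le> 2 \<longrightarrow> ruppert_rank f \<le> 59) \<and>
    (\<forall>B C.
       vfield.independent B \<and> vfield.span B = sl1 \<and>
       mpoly.independent C \<and> mpoly.span C = forms 4 \<longrightarrow>
       (\<forall>(r :: 60 \<Rightarrow> form) s. inj r \<and> range r \<subseteq> C \<and> inj s \<and> range s \<subseteq> B \<longrightarrow>
          (\<exists>P \<in> coord_ring 3 \<inter> forms 60.
             (\<forall>f\<in>forms 3. eval_form P f = ruppert_minor C r s f) \<and>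
             vanishes_on P (secant2 3 reducible_cubics))) \<and>
       (\<exists>(r :: 60 \<Rightarrow> form) s. inj r \<and> range r \<subseteq> C \<and> inj s \<and> range s \<subseteq> B \<and>
          (\<exists>f\<in>forms 3. ruppert_minor C r s f \<noteq> 0)))"
proof (intro conjI allI impI ballI)
  show "\<exists>U. zariski_open 3 U \<and> U \<noteq> {} \<and> (\<forall>f\<in>U. ruppert_rank f = 60)"
    by (rule generic_rank)
next
  fix f :: form assume "f \<in> forms 3" "slice_rank 3 f \<le> 2"
  then obtain l l' h h' where "l \<in> forms 1" "l' \<in> forms 1" "h \<in> forms 2" "h' \<in> forms 2"
    "f = l * h + l' * h'"
    by (rule slice_rank_le_2_imp)
  then show "ruppert_rank f \<le> 59"
    using ruppert_rank_le_59 by simp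
next
  fix B C and r :: "60 \<Rightarrow> form" and s :: "60 \<Rightarrow> form ^ 5"
  assume BC: "vfield.independent B \<and> vfield.span B = sl1 \<and>
      mpoly.independent C \<and> mpoly.span C = forms 4"
    and rs: "inj r \<and> range r \<subseteq> C \<and> inj s \<and> range s \<subseteq> B"
  have sl: "range s \<subseteq> sl1"
    using rs BC vfield.span_superset[of B] by auto
  have C: "mpoly.independent C" "mpoly.span C = forms 4"
    using BC by auto
  note eval = eval_minor_poly[OF C _ sl, where r = r]
  have P: "minor_poly C r s \<in> coord_ring 3" "minor_poly C r s \<in> forms 60"
    using minor_poly_in_forms[of C r s] by (simp_all add: minor_poly_in_coord_ring)
  moreover have "vanishes_on (minor_poly C r s) (secant2 3 reducible_cubics)"
  proof (rule vanishes_on_secant[OF P])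
    fix l l' h h' :: form
    assume forms: "l \<in> forms 1" "l' \<in> forms 1" "h \<in> forms 2" "h' \<in> forms 2"
    have "l * h \<in> forms 3" "l' * h' \<in> forms 3"
      using forms by (simp_all add: linear_times_quadric_in_forms del: One_nat_def)
    then have f: "l * h + l' * h' \<in> forms 3"
      by (rule forms_add)
    have "ruppert_minor C r s (l * h + l' * h') = 0"
      using card_le_rank_if_minor_nonzero[OF C f sl, of r] ruppert_rank_le_59[OF forms] by fastforce
    then show "eval_form (minor_poly C r s) (l * h + l' * h') = 0"
      using eval[OF f] by simp
  qed
  ultimately show "\<exists>P \<in> coord_ring 3 \<inter> forms 60.
      (\<forall>f\<in>forms 3. eval_form P f = ruppert_minor C r s f) \<and>
      vanishes_on P (secant2 3 reducible_cubics)"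
    using eval by (intro bexI[of _ "minor_poly C r s"]) auto
next
  fix B and C :: "form set"
  assume BC: "vfield.independent B \<and> vfield.span B = sl1 \<and>
      mpoly.independent C \<and> mpoly.span C = forms 4"
  have "CARD(60) \<le> ruppert_rank fermat_cubic"
    using fermat_rank by simp
  then obtain r :: "60 \<Rightarrow> form" and s where "inj r" "range r \<subseteq> C" "inj s" "range s \<subseteq> B"
    "ruppert_minor C r s fermat_cubic \<noteq> 0"
    using exists_nonzero_minor[of B C fermat_cubic] BC fermat_cubic_in_forms by metis
  then show "\<exists>(r :: 60 \<Rightarrow> form) s. inj r \<and> range r \<subseteq> C \<and> inj s \<and> range s \<subseteq> B \<and>
      (\<exists>f\<in>forms 3. ruppert_minor C r s f \<noteq> 0)"
    using fermat_cubic_in_forms by blast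
qed

end
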